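(* Let $d>1$ and $0<\lambda<\infty$. Let $T$ be a random $\mathrm{Poisson}(d)$ tree. Then the conditional probability, given that $T$ is infinite, that the hard-core model on $T$ with fugacity $\lambda$ has weak spatial mixing is either $0$ or $1$. Likewise, the conditional probability, given that $T$ is infinite, that the hard-core model on $T$ with fugacity $\lambda$ has strong spatial mixing is either $0$ or $1$.
   Context: Poisson tree: for $d>0$, $\mathrm{Poisson}(d)$ denotes the random rooted tree in which every vertex independently has a random number of children with distribution $\Pr(X=i)=e^{-d}d^i/i!$, $i\ge 0$ (the Galton–Watson tree with Poisson offspring of mean $d$). Hard-core model with finite fugacity $\lambda$ on a graph $G$ (locally finite): configurations are independent sets of $G$ (each vertex is "occupied" or "unoccupied", no two adjacent vertices are occupied). For a finite vertex set $\Psi$, let $\partial\Psi=\{v\in\Psi : v \text{ has a neighbor not in } \Psi\}$. For a boundary condition $\sigma$ on $\partial\Psi$ (an assignment of occupied/unoccupied with no two adjacent occupied vertices), $\mu_\Psi^\sigma$ is the probability distribution on independent sets $S$ of the subgraph induced by $\Psi$ that agree with $\sigma$ on $\partial\Psi$, with probability proportional to $\lambda^{|S|}$. Weak spatial mixing (WSM): for every finite vertex set $\Lambda$, and every sequence of triples $(\Psi_n,\sigma_n,\tau_n)$ with $\Psi_n\supset\Lambda$ finite and $\sigma_n,\tau_n$ boundary conditions on $\partial\Psi_n$, if $\mathrm{dist}(\Lambda,\partial\Psi_n)\to\infty$ then $\|\mu_{\Psi_n}^{\sigma_n}-\mu_{\Psi_n}^{\tau_n}\|_\Lambda\to 0$,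 where $\|\cdot\|_\Lambda$ is the total variation distance between the marginals on $\Lambda$ (distance to the empty set is $+\infty$). WSM is equivalent to uniqueness of the Gibbs measure. Strong spatial mixing (SSM): the analogous property in which only the set of vertices on which the two boundary conditions disagree is required to be at distance tending to infinity from $\Lambda$ (nearer vertices may be frozen identically in both). For independent sets this is taken in the equivalent form: SSM holds on $G$ if and only if WSM holds for the hard-core model (with the same fugacity) on every subgraph of $G$. *)

theory Defs
  imports "HOL-Probability.Probability"
begin

section \<open>Graphs\<close>

text \<open>
  A simple graph, possibly infinite, is a pair of a vertex set and a set of two-element edges.
\<close>

type_synonym 'a graph = "'a set \<times> 'a set set"

abbreviation verts :: "'a graph \<Rightarrow> 'a set" where "verts \<equiv> fst"
abbreviation edges :: "'a graph \<Rightarrow> 'a set set" where "edges \<equiv> snd"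

definition simple_graph :: "'a graph \<Rightarrow> bool" where
  "simple_graph G \<longleftrightarrow> (\<forall>e\<in>edges G. e \<subseteq> verts G \<and> card e = 2)"

definition adj :: "'a graph \<Rightarrow> 'a \<Rightarrow> 'a \<Rightarrow> bool" where
  "adj G u v \<longleftrightarrow> {u, v} \<in> edges G"

text \<open>Subgraphs need not be induced.\<close>

definition subgraph :: "'a graph \<Rightarrow> 'a graph \<Rightarrow> bool" where
  "subgraph H G \<longleftrightarrow> simple_graph H \<and> verts H \<subseteq> verts G \<and> edges H \<subseteq> edges G"

text \<open>
  The length of a shortest walk from \<open>A\<close> to \<open>B\<close>. It is \<open>\<infinity>\<close> if there is none, in particular if
  \<open>A\<close> or \<open>B\<close> is empty.
\<close>

definition graph_dist :: "'a graph \<Rightarrow> 'a set \<Rightarrow> 'a set \<Rightarrow> enat" where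
  "graph_dist G A B = Inf {enat n | n u v. u \<in> A \<and> v \<in> B \<and> (adj G ^^ n) u v}"

definition boundary :: "'a graph \<Rightarrow> 'a set \<Rightarrow> 'a set" where
  "boundary G \<Psi> = {v \<in> \<Psi>. \<exists>w. adj G v w \<and> w \<notin> \<Psi>}"


section \<open>The hard-core model\<close>

definition indep_set :: "'a graph \<Rightarrow> 'a set \<Rightarrow> bool" where
  "indep_set G S \<longleftrightarrow> S \<subseteq> verts G \<and> (\<forall>u\<in>S. \<forall>v\<in>S. \<not> adj G u v)"

text \<open>
  A boundary condition, i.e. an assignment of occupied/unoccupied to the vertices of
  \<^term>\<open>boundary G \<Psi>\<close>, is represented by its set of occupied vertices.
\<close>

definition boundary_condition :: "'a graph \<Rightarrow> 'a set \<Rightarrow> 'a set \<Rightarrow> bool" where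
  "boundary_condition G \<Psi> \<sigma> \<longleftrightarrow> \<sigma> \<subseteq> boundary G \<Psi> \<and> indep_set G \<sigma>"

definition hc_configs :: "'a graph \<Rightarrow> 'a set \<Rightarrow> 'a set \<Rightarrow> 'a set set" where
  "hc_configs G \<Psi> \<sigma> = {S. S \<subseteq> \<Psi> \<and> indep_set G S \<and> S \<inter> boundary G \<Psi> = \<sigma>}"

definition hc_pmf :: "'a graph \<Rightarrow> real \<Rightarrow> 'a set \<Rightarrow> 'a set \<Rightarrow> 'a set pmf" where
  "hc_pmf G lam \<Psi> \<sigma> = embed_pmf (\<lambda>S.
     if S \<in> hc_configs G \<Psi> \<sigma> then lam ^ card S / (\<Sum>S'\<in>hc_configs G \<Psi> \<sigma>. lam ^ card S') else 0)"

text \<open>The weights in \<^const>\<open>hc_pmf\<close> are those of a probability distribution:\<close>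

lemma pmf_hc_pmf:
  assumes "lam > 0" "finite \<Psi>" "boundary_condition G \<Psi> \<sigma>"
  shows "pmf (hc_pmf G lam \<Psi> \<sigma>) S =
    (if S \<in> hc_configs G \<Psi> \<sigma> then lam ^ card S / (\<Sum>S'\<in>hc_configs G \<Psi> \<sigma>. lam ^ card S') else 0)"
proof -
  define C where "C = hc_configs G \<Psi> \<sigma>"
  define Z where "Z = (\<Sum>S'\<in>C. lam ^ card S')"
  define f where "f = (\<lambda>S. if S \<in> C then lam ^ card S / Z else 0)"
  have fin: "finite C"
    using assms(2) by (rule_tac finite_subset[of _ "Pow \<Psi>"]) (auto simp: C_def hc_configs_def)
  have "\<sigma> \<in> C"
    using assms(3) by (auto simp: C_def hc_configs_def boundary_condition_def boundary_def)
  then have Z: "Z > 0"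
    unfolding Z_def using assms(1) fin by (intro sum_pos) auto
  have nonneg: "f S \<ge> 0" for S
    using Z assms(1) by (simp add: f_def)
  have "(\<integral>\<^sup>+S. ennreal (f S) \<partial>count_space UNIV) = (\<Sum>S\<in>C. ennreal (f S))"
    using fin by (intro nn_integral_count_space') (auto simp: f_def split: if_splits)
  also have "\<dots> = ennreal (\<Sum>S\<in>C. f S)"
    using nonneg by (simp add: sum_ennreal)
  also have "(\<Sum>S\<in>C. f S) = (\<Sum>S\<in>C. lam ^ card S) / Z"
    by (simp add: f_def sum_divide_distrib)
  also have "\<dots> = 1"
    using Z by (simp add: Z_def)
  finally have "(\<integral>\<^sup>+S. ennreal (f S) \<partial>count_space UNIV) = 1"
    by simp
  from pmf_embed_pmf[of f, OF nonneg this] show ?thesis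
    unfolding hc_pmf_def f_def Z_def C_def .
qed

definition tv_dist :: "'b pmf \<Rightarrow> 'b pmf \<Rightarrow> real" where
  "tv_dist p q = (SUP A. \<bar>measure_pmf.prob p A - measure_pmf.prob q A\<bar>)"

text \<open>The total variation distance between the restrictions of two random sets to \<open>\<Lambda>\<close>:\<close>

definition tv_dist_on :: "'a set \<Rightarrow> 'a set pmf \<Rightarrow> 'a set pmf \<Rightarrow> real" where
  "tv_dist_on \<Lambda> p q = tv_dist (map_pmf (\<lambda>S. S \<inter> \<Lambda>) p) (map_pmf (\<lambda>S. S \<inter> \<Lambda>) q)"

definition weak_spatial_mixing :: "'a graph \<Rightarrow> real \<Rightarrow> bool" where
  "weak_spatial_mixing G lam \<longleftrightarrow>
    (\<forall>\<Lambda> (\<Psi> :: nat \<Rightarrow> 'a set) \<sigma> \<tau>.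
       finite \<Lambda> \<longrightarrow> \<Lambda> \<subseteq> verts G \<longrightarrow>
       (\<forall>n. finite (\<Psi> n) \<and> \<Lambda> \<subseteq> \<Psi> n \<and> \<Psi> n \<subseteq> verts G \<and>
            boundary_condition G (\<Psi> n) (\<sigma> n) \<and> boundary_condition G (\<Psi> n) (\<tau> n)) \<longrightarrow>
       (\<lambda>n. graph_dist G \<Lambda> (boundary G (\<Psi> n))) \<longlonglongrightarrow> \<infinity> \<longrightarrow>
       (\<lambda>n. tv_dist_on \<Lambda> (hc_pmf G lam (\<Psi> n) (\<sigma> n)) (hc_pmf G lam (\<Psi> n) (\<tau> n))) \<longlonglongrightarrow> 0)"

text \<open>
  For independent sets, boundary conditions that agree near \<open>\<Lambda>\<close> can be absorbed by deleting
  the frozen vertices (and the neighbours of the occupied ones). Strong spatial mixing is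
  therefore taken to be weak spatial mixing on every subgraph.
\<close>

definition strong_spatial_mixing :: "'a graph \<Rightarrow> real \<Rightarrow> bool" where
  "strong_spatial_mixing G lam \<longleftrightarrow> (\<forall>H. subgraph H G \<longrightarrow> weak_spatial_mixing H lam)"


section \<open>Poisson trees\<close>

text \<open>
  Ulam--Harris encoding: vertices are finite sequences of naturals, the root is \<^term>\<open>[]\<close>, and
  a vertex \<open>v\<close> of the tree has the children \<open>v @ [0]\<close>, \dots, \<open>v @ [c v - 1]\<close>, where \<open>c v\<close>
  is its number of children. The values of \<open>c\<close> outside the tree play no role.
\<close>

definition tree_verts :: "(nat list \<Rightarrow> nat) \<Rightarrow> nat list set" where
  "tree_verts c = {v. \<forall>k<length v. v ! k < c (take k v)}"

definition tree_of :: "(nat list \<Rightarrow> nat) \<Rightarrow> nat list graph" where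
  "tree_of c = (tree_verts c, {{v, v @ [i]} | v i. v @ [i] \<in> tree_verts c})"

text \<open>
  Under this measure the offspring numbers are independent and Poisson distributed with mean
  \<open>d\<close>, so \<^const>\<open>tree_of\<close> is the Poisson(\<open>d\<close>) tree.
\<close>

definition poisson_offspring :: "real \<Rightarrow> (nat list \<Rightarrow> nat) measure" where
  "poisson_offspring d = (\<Pi>\<^sub>M v\<in>UNIV. measure_pmf (poisson_pmf d))"

end

theory Submission
  imports Defs
begin

text \<open>
  Both mixing properties hold on finite trees and pass from a tree to the subtrees of the children
  of its root: for strong mixing because subgraphs of subtrees are subgraphs, for weak mixing because
  the model on a child's subtree is the model on the whole tree conditioned on the root being
  unoccupied, an event of probability at least \<open>1 / (1 + lam)\<close>. The probability \<open>p\<close> of such an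
  inherited property satisfies \<open>p \<le> exp (d * (p - 1))\<close>, while the extinction probability \<open>q \<le> p\<close> is a
  fixed point of the right-hand side. By strict convexity \<open>p\<close> is \<open>q\<close> or 1, which is the zero-one law.

  Weak mixing is a countable combination of events that depend on finitely many vertices. Strong
  mixing quantifies over uncountably many subgraphs, but by compactness it is uniform over them, so
  that finite subgraphs suffice; this gives measurability.
\<close>


section \<open>Balls and marginals\<close>

text \<open>A limit along arbitrary sequences of volumes and boundary conditions lends itself
  neither to measurability nor to compactness. It is replaced by a test in one finite volume: any
  boundary condition of a larger volume acts on a smaller one through a mixture of the smaller
  volume's own boundary conditions, so a small spread of marginals in one volume bounds the spread
  in all larger ones. Such a test sees only a finite piece of the graph.

  Weak mixing says nothing about subgraphs as such, which makes the passage to a child's subtree the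
  delicate step. A conditional probability given a vacant root is a quotient of two marginals on the
  whole tree; both lose their dependence on the boundary, and the bound \<open>1 / (1 + lam)\<close>
  keeps the denominator away from 0.

  Inheritance goes one way, from the tree to the subtrees, which is why \<open>p\<close> satisfies
  an inequality only. This is enough: if \<open>q < 1\<close>, the strictly convex function
  \<open>exp (d * (s - 1)) - s\<close> vanishes at \<open>q\<close> and at 1, hence is negative
  strictly between them.\<close>

lemma adj_commute: "adj G u v \<longleftrightarrow> adj G v u"
  by (simp add: adj_def insert_commute)

primrec graph_ball :: "'a graph \<Rightarrow> 'a set \<Rightarrow> nat \<Rightarrow> 'a set" where
  "graph_ball G \<Lambda> 0 = \<Lambda>"
| "graph_ball G \<Lambda> (Suc r) = graph_ball G \<Lambda> r \<union> {v. \<exists>u\<in>graph_ball G \<Lambda> r. adj G u v}"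

lemma graph_ball_mono: "r \<le> s \<Longrightarrow> graph_ball G \<Lambda> r \<subseteq> graph_ball G \<Lambda> s"
  by (rule lift_Suc_mono_le[of "graph_ball G \<Lambda>"]) auto

lemma subset_graph_ball: "\<Lambda> \<subseteq> graph_ball G \<Lambda> r"
  using graph_ball_mono[of 0 r G \<Lambda>] by simp

lemma graph_ball_iff_walk: "v \<in> graph_ball G \<Lambda> r \<longleftrightarrow> (\<exists>n\<le>r. \<exists>u\<in>\<Lambda>. (adj G ^^ n) u v)"
proof
  show "v \<in> graph_ball G \<Lambda> r \<Longrightarrow> \<exists>n\<le>r. \<exists>u\<in>\<Lambda>. (adj G ^^ n) u v"
  proof (induction r arbitrary: v)
    case (Suc r)
    show ?case
    proof (cases "v \<in> graph_ball G \<Lambda> r")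
      case True
      then show ?thesis using Suc.IH by (meson le_SucI)
    next
      case False
      then obtain w where w: "w \<in> graph_ball G \<Lambda> r" "adj G w v" using Suc.prems by auto
      then obtain n u where "n \<le> r" "u \<in> \<Lambda>" "(adj G ^^ n) u w" using Suc.IH by blast
      with w(2) have "Suc n \<le> Suc r" "u \<in> \<Lambda>" "(adj G ^^ Suc n) u v" by auto
      then show ?thesis by blast
    qed
  qed auto
next
  assume "\<exists>n\<le>r. \<exists>u\<in>\<Lambda>. (adj G ^^ n) u v"
  then obtain n u where n: "n \<le> r" "u \<in> \<Lambda>" "(adj G ^^ n) u v" by blast
  from n(3) have "v \<in> graph_ball G \<Lambda> n"
    using n(2) by (induction n arbitrary: v) auto
  then show "v \<in> graph_ball G \<Lambda> r"
    by (rule subsetD[OF graph_ball_mono[OF n(1)]])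
qed

text \<open>Removes \<open>enat\<close> and infima from the argument. The convention for unreachable
  or empty sets agrees on both sides: the distance is then \<infinity>, and every ball misses the
  set.\<close>

lemma less_graph_dist_iff: "enat r < graph_dist G \<Lambda> B \<longleftrightarrow> graph_ball G \<Lambda> r \<inter> B = {}"
proof -
  define W where "W = {enat n | n u v. u \<in> \<Lambda> \<and> v \<in> B \<and> (adj G ^^ n) u v}"
  have "enat r < Inf W \<longleftrightarrow> enat (Suc r) \<le> Inf W"
    by (metis Suc_ile_eq)
  also have "\<dots> \<longleftrightarrow> (\<forall>x\<in>W. enat (Suc r) \<le> x)"
    by (simp add: le_Inf_iff)
  also have "\<dots> \<longleftrightarrow> graph_ball G \<Lambda> r \<inter> B = {}"
  proof
    assume *: "\<forall>x\<in>W. enat (Suc r) \<le> x"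
    have "\<not> (adj G ^^ n) u v" if "n \<le> r" "u \<in> \<Lambda>" "v \<in> B" for n u v
      using that *[THEN bspec, of "enat n"] by (auto simp: W_def)
    then show "graph_ball G \<Lambda> r \<inter> B = {}" by (auto simp: graph_ball_iff_walk)
  next
    assume *: "graph_ball G \<Lambda> r \<inter> B = {}"
    have "Suc r \<le> n" if "u \<in> \<Lambda>" "v \<in> B" "(adj G ^^ n) u v" for n u v
      using * that by (auto simp: disjoint_iff graph_ball_iff_walk not_less_eq_eq[symmetric])
    then show "\<forall>x\<in>W. enat (Suc r) \<le> x" by (auto simp: W_def)
  qed
  finally show ?thesis by (simp add: graph_dist_def W_def)
qed

text \<open>A walk can leave \<open>\<Psi>\<close> only from a boundary vertex. The radius grows by
  one because the vertices of the \<open>r\<close>-ball, not being boundary vertices, have all their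
  neighbours in \<open>\<Psi>\<close>.\<close>

lemma graph_ball_subset_if_disjoint_boundary:
  assumes "\<Lambda> \<subseteq> \<Psi>" "graph_ball G \<Lambda> r \<inter> boundary G \<Psi> = {}"
  shows "graph_ball G \<Lambda> (Suc r) \<subseteq> \<Psi>"
  using assms(2)
proof (induction r)
  case 0
  then show ?case using assms(1) by (auto simp: boundary_def)
next
  case (Suc r)
  then have "graph_ball G \<Lambda> (Suc r) \<subseteq> \<Psi>" by auto
  then show ?case using Suc.prems by (auto simp: boundary_def)
qed

text \<open>Together with the preceding lemma this makes the ball of radius \<open>Suc r\<close> the
  smallest volume around \<open>\<Lambda>\<close> whose boundary avoids the ball of radius
  \<open>r\<close>.\<close>

lemma graph_ball_disjoint_boundary: "graph_ball G \<Lambda> r \<inter> boundary G (graph_ball G \<Lambda> (Suc r)) = {}"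
  by (auto simp: boundary_def)

lemma graph_ball_subset_verts:
  assumes "simple_graph G" "\<Lambda> \<subseteq> verts G"
  shows "graph_ball G \<Lambda> r \<subseteq> verts G"
  using assms by (induction r) (auto simp: adj_def simple_graph_def)

lemma graph_ball_mono_graph:
  assumes "\<And>u v. adj H u v \<Longrightarrow> adj G u v"
  shows "graph_ball H \<Lambda> r \<subseteq> graph_ball G \<Lambda> r"
  using assms by (induction r) auto

lemma boundary_mono:
  assumes "\<Psi>0 \<subseteq> \<Psi>" shows "\<Psi>0 \<inter> boundary G \<Psi> \<subseteq> boundary G \<Psi>0"
  using assms by (auto simp: boundary_def)

section \<open>Finite-volume weights, marginals and total variation\<close>

definition hc_weight :: "'a graph \<Rightarrow> real \<Rightarrow> 'a set \<Rightarrow> 'a set \<Rightarrow> 'a set \<Rightarrow> 'a set \<Rightarrow> real" where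
  "hc_weight G lam \<Psi> \<sigma> \<Lambda> A = (\<Sum>S | S \<in> hc_configs G \<Psi> \<sigma> \<and> S \<inter> \<Lambda> = A. lam ^ card S)"

text \<open>Taking \<open>\<Lambda> = A = {}\<close> imposes no constraint, so the denominator is the partition function.\<close>

definition hc_marginal :: "'a graph \<Rightarrow> real \<Rightarrow> 'a set \<Rightarrow> 'a set \<Rightarrow> 'a set \<Rightarrow> 'a set \<Rightarrow> real" where
  "hc_marginal G lam \<Psi> \<sigma> \<Lambda> A = hc_weight G lam \<Psi> \<sigma> \<Lambda> A / hc_weight G lam \<Psi> \<sigma> {} {}"

lemma finite_hc_configs: "finite \<Psi> \<Longrightarrow> finite (hc_configs G \<Psi> \<sigma>)"
  by (rule finite_subset[of _ "Pow \<Psi>"]) (auto simp: hc_configs_def)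

lemma finite_boundary: "finite \<Psi> \<Longrightarrow> finite (boundary G \<Psi>)"
  by (simp add: boundary_def)

lemma boundary_condition_in_hc_configs:
  "boundary_condition G \<Psi> \<sigma> \<Longrightarrow> \<sigma> \<in> hc_configs G \<Psi> \<sigma>"
  by (auto simp: hc_configs_def boundary_condition_def boundary_def)

lemma hc_weight_nonneg: "lam \<ge> 0 \<Longrightarrow> hc_weight G lam \<Psi> \<sigma> \<Lambda> A \<ge> 0"
  by (simp add: hc_weight_def sum_nonneg)

lemma hc_weight_total_pos:
  assumes "lam > 0" "finite \<Psi>" "boundary_condition G \<Psi> \<sigma>"
  shows "hc_weight G lam \<Psi> \<sigma> {} {} > 0"
  using assms boundary_condition_in_hc_configs[of G \<Psi> \<sigma>] finite_hc_configs[of \<Psi> G \<sigma>]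
  unfolding hc_weight_def by (intro sum_pos) auto

text \<open>The bridge from the probability mass functions of the definitions to quotients of finite
  sums, in which the combinatorial identities and the measurability proofs are carried out.\<close>

lemma pmf_map_hc_pmf:
  assumes "lam > 0" "finite \<Psi>" "boundary_condition G \<Psi> \<sigma>"
  shows "pmf (map_pmf (\<lambda>S. S \<inter> \<Lambda>) (hc_pmf G lam \<Psi> \<sigma>)) A = hc_marginal G lam \<Psi> \<sigma> \<Lambda> A"
proof -
  let ?p = "hc_pmf G lam \<Psi> \<sigma>" and ?C = "hc_configs G \<Psi> \<sigma>"
  have set: "set_pmf ?p \<subseteq> ?C"
    using pmf_hc_pmf[OF assms] by (auto simp: set_pmf_iff split: if_splits)
  have "pmf (map_pmf (\<lambda>S. S \<inter> \<Lambda>) ?p) A = measure_pmf.prob ?p ((\<lambda>S. S \<inter> \<Lambda>) -` {A})"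
    by (rule pmf_map)
  also have "\<dots> = measure_pmf.prob ?p {S \<in> ?C. S \<inter> \<Lambda> = A}"
    using set by (intro measure_pmf.finite_measure_eq_AE AE_pmfI) auto
  also have "\<dots> = (\<Sum>S | S \<in> ?C \<and> S \<inter> \<Lambda> = A. pmf ?p S)"
    using finite_hc_configs[OF assms(2), of G \<sigma>] by (intro measure_measure_pmf_finite) auto
  also have "\<dots> = (\<Sum>S | S \<in> ?C \<and> S \<inter> \<Lambda> = A. lam ^ card S / hc_weight G lam \<Psi> \<sigma> {} {})"
    by (intro sum.cong) (auto simp: pmf_hc_pmf[OF assms] hc_weight_def)
  finally show ?thesis by (simp add: hc_marginal_def hc_weight_def sum_divide_distrib)
qed

lemma tv_dist_ge_pmf: "\<bar>pmf p x - pmf q x\<bar> \<le> tv_dist p q"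
proof -
  have "\<bar>measure_pmf.prob p A - measure_pmf.prob q A\<bar> \<le> 1" for A
    using measure_pmf.prob_le_1[of p A] measure_pmf.prob_le_1[of q A]
      measure_nonneg[of "measure_pmf p" A] measure_nonneg[of "measure_pmf q" A] by linarith
  then have "bdd_above (range (\<lambda>A. \<bar>measure_pmf.prob p A - measure_pmf.prob q A\<bar>))"
    by (auto intro!: bdd_aboveI)
  from cSUP_upper[OF _ this, of "{x}"] show ?thesis
    by (simp add: tv_dist_def measure_pmf_single)
qed

text \<open>With \<open>tv_dist_ge_pmf\<close> this makes closeness in total variation on a finite
  set equivalent, up to a factor \<open>card F\<close>, to closeness of each single mass.\<close>

lemma tv_dist_le_sum_pmf:
  assumes "finite F" "set_pmf p \<subseteq> F" "set_pmf q \<subseteq> F"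
  shows "tv_dist p q \<le> (\<Sum>x\<in>F. \<bar>pmf p x - pmf q x\<bar>)"
  unfolding tv_dist_def
proof (rule cSUP_least)
  fix A
  have *: "measure_pmf.prob r A = (\<Sum>x\<in>A \<inter> F. pmf r x)" if "set_pmf r \<subseteq> F" for r
  proof -
    have "measure_pmf.prob r A = measure_pmf.prob r (A \<inter> F)"
      using that by (intro measure_pmf.finite_measure_eq_AE AE_pmfI) auto
    then show ?thesis using assms(1) by (simp add: measure_measure_pmf_finite)
  qed
  have "\<bar>measure_pmf.prob p A - measure_pmf.prob q A\<bar> = \<bar>\<Sum>x\<in>A \<inter> F. pmf p x - pmf q x\<bar>"
    using assms by (simp add: * sum_subtractf)
  also have "\<dots> \<le> (\<Sum>x\<in>A \<inter> F. \<bar>pmf p x - pmf q x\<bar>)" by (rule sum_abs)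
  also have "\<dots> \<le> (\<Sum>x\<in>F. \<bar>pmf p x - pmf q x\<bar>)"
    using assms(1) by (intro sum_mono2) auto
  finally show "\<bar>measure_pmf.prob p A - measure_pmf.prob q A\<bar> \<le> (\<Sum>x\<in>F. \<bar>pmf p x - pmf q x\<bar>)" .
qed simp

section \<open>Weak mixing as a criterion on finite volumes\<close>

definition small_gap :: "'a graph \<Rightarrow> real \<Rightarrow> 'a set \<Rightarrow> 'a set \<Rightarrow> real \<Rightarrow> bool" where
  "small_gap G lam \<Lambda> \<Psi> \<epsilon> \<longleftrightarrow> (\<forall>\<sigma> \<tau> A. boundary_condition G \<Psi> \<sigma> \<longrightarrow> boundary_condition G \<Psi> \<tau> \<longrightarrow>
     \<bar>hc_marginal G lam \<Psi> \<sigma> \<Lambda> A - hc_marginal G lam \<Psi> \<tau> \<Lambda> A\<bar> < \<epsilon>)"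

definition insensitive_beyond :: "'a graph \<Rightarrow> real \<Rightarrow> 'a set \<Rightarrow> real \<Rightarrow> nat \<Rightarrow> bool" where
  "insensitive_beyond G lam \<Lambda> \<epsilon> r \<longleftrightarrow>
    (\<forall>\<Psi>. finite \<Psi> \<longrightarrow> \<Lambda> \<subseteq> \<Psi> \<longrightarrow> \<Psi> \<subseteq> verts G \<longrightarrow> graph_ball G \<Lambda> r \<inter> boundary G \<Psi> = {} \<longrightarrow>
       small_gap G lam \<Lambda> \<Psi> \<epsilon>)"

text \<open>If every radius \<open>r\<close> failed, one bad volume and one bad pair of boundary
  conditions per radius would form a single sequence with distance tending to infinity along which
  the marginals stay \<open>\<epsilon>\<close> apart. Conversely, a distance tending to infinity
  eventually exceeds any given radius.\<close>

lemma weak_spatial_mixing_iff: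
  assumes lam: "lam > 0"
  shows "weak_spatial_mixing G lam \<longleftrightarrow>
    (\<forall>\<Lambda> \<epsilon>. finite \<Lambda> \<longrightarrow> \<Lambda> \<subseteq> verts G \<longrightarrow> \<epsilon> > 0 \<longrightarrow> (\<exists>r. insensitive_beyond G lam \<Lambda> \<epsilon> r))"
proof (intro iffI allI impI)
  fix \<Lambda> and \<epsilon> :: real
  assume wsm: "weak_spatial_mixing G lam" and \<Lambda>: "finite \<Lambda>" "\<Lambda> \<subseteq> verts G" and \<epsilon>: "\<epsilon> > 0"
  show "\<exists>r. insensitive_beyond G lam \<Lambda> \<epsilon> r"
  proof (rule ccontr)
    assume "\<nexists>r. insensitive_beyond G lam \<Lambda> \<epsilon> r"
    then have "\<forall>r. \<exists>\<Psi>. finite \<Psi> \<and> \<Lambda> \<subseteq> \<Psi> \<and> \<Psi> \<subseteq> verts G \<and>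
        graph_ball G \<Lambda> r \<inter> boundary G \<Psi> = {} \<and> \<not> small_gap G lam \<Lambda> \<Psi> \<epsilon>"
      by (simp add: insensitive_beyond_def)
    from choice[OF this] obtain \<Psi> where \<Psi>: "\<forall>r. finite (\<Psi> r) \<and> \<Lambda> \<subseteq> \<Psi> r \<and> \<Psi> r \<subseteq> verts G \<and>
        graph_ball G \<Lambda> r \<inter> boundary G (\<Psi> r) = {} \<and> \<not> small_gap G lam \<Lambda> (\<Psi> r) \<epsilon>" ..
    then have "\<forall>r. \<exists>\<sigma> \<tau>. boundary_condition G (\<Psi> r) \<sigma> \<and> boundary_condition G (\<Psi> r) \<tau> \<and>
        (\<exists>A. \<not> \<bar>hc_marginal G lam (\<Psi> r) \<sigma> \<Lambda> A - hc_marginal G lam (\<Psi> r) \<tau> \<Lambda> A\<bar> < \<epsilon>)"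
      by (simp add: small_gap_def)
    from choice[OF this] obtain \<sigma> where "\<forall>r. \<exists>\<tau>. boundary_condition G (\<Psi> r) (\<sigma> r) \<and> boundary_condition G (\<Psi> r) \<tau> \<and>
        (\<exists>A. \<not> \<bar>hc_marginal G lam (\<Psi> r) (\<sigma> r) \<Lambda> A - hc_marginal G lam (\<Psi> r) \<tau> \<Lambda> A\<bar> < \<epsilon>)" ..
    from choice[OF this] obtain \<tau> where
      bc: "\<forall>r. boundary_condition G (\<Psi> r) (\<sigma> r) \<and> boundary_condition G (\<Psi> r) (\<tau> r) \<and>
        (\<exists>A. \<not> \<bar>hc_marginal G lam (\<Psi> r) (\<sigma> r) \<Lambda> A - hc_marginal G lam (\<Psi> r) (\<tau> r) \<Lambda> A\<bar> < \<epsilon>)" ..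
    have lim: "(\<lambda>n. graph_dist G \<Lambda> (boundary G (\<Psi> n))) \<longlonglongrightarrow> \<infinity>"
    proof (rule order_tendstoI)
      fix a :: enat assume "a < \<infinity>"
      then obtain m where m: "a = enat m" by (cases a) auto
      show "\<forall>\<^sub>F n in sequentially. a < graph_dist G \<Lambda> (boundary G (\<Psi> n))"
        using eventually_ge_at_top[of m]
      proof eventually_elim
        case (elim n)
        then have "graph_ball G \<Lambda> m \<inter> boundary G (\<Psi> n) = {}"
          using \<Psi>[rule_format, of n] graph_ball_mono[of m n G \<Lambda>] by blast
        then show ?case by (simp add: m less_graph_dist_iff)
      qed
    qed (simp add: not_less)
    have "(\<lambda>n. tv_dist_on \<Lambda> (hc_pmf G lam (\<Psi> n) (\<sigma> n)) (hc_pmf G lam (\<Psi> n) (\<tau> n))) \<longlonglongrightarrow> 0"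
      by (rule wsm[unfolded weak_spatial_mixing_def, rule_format, OF \<Lambda> _ lim]) (use \<Psi> bc in simp)
    then have "\<forall>\<^sub>F n in sequentially. tv_dist_on \<Lambda> (hc_pmf G lam (\<Psi> n) (\<sigma> n)) (hc_pmf G lam (\<Psi> n) (\<tau> n)) < \<epsilon>"
      using \<epsilon> by (rule order_tendstoD)
    then obtain n where n: "tv_dist_on \<Lambda> (hc_pmf G lam (\<Psi> n) (\<sigma> n)) (hc_pmf G lam (\<Psi> n) (\<tau> n)) < \<epsilon>"
      using eventually_happens'[OF sequentially_bot] by blast
    obtain A where A: "\<bar>hc_marginal G lam (\<Psi> n) (\<sigma> n) \<Lambda> A - hc_marginal G lam (\<Psi> n) (\<tau> n) \<Lambda> A\<bar> \<ge> \<epsilon>"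
      using bc by (meson not_less)
    then have "\<epsilon> \<le> \<bar>pmf (map_pmf (\<lambda>S. S \<inter> \<Lambda>) (hc_pmf G lam (\<Psi> n) (\<sigma> n))) A -
        pmf (map_pmf (\<lambda>S. S \<inter> \<Lambda>) (hc_pmf G lam (\<Psi> n) (\<tau> n))) A\<bar>"
      using \<Psi> bc lam by (simp add: pmf_map_hc_pmf)
    also have "\<dots> \<le> tv_dist_on \<Lambda> (hc_pmf G lam (\<Psi> n) (\<sigma> n)) (hc_pmf G lam (\<Psi> n) (\<tau> n))"
      unfolding tv_dist_on_def by (rule tv_dist_ge_pmf)
    finally show False using n by simp
  qed
next
  assume R: "\<forall>\<Lambda> \<epsilon>. finite \<Lambda> \<longrightarrow> \<Lambda> \<subseteq> verts G \<longrightarrow> \<epsilon> > 0 \<longrightarrow> (\<exists>r. insensitive_beyond G lam \<Lambda> \<epsilon> r)"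
  show "weak_spatial_mixing G lam"
    unfolding weak_spatial_mixing_def
  proof (intro allI impI)
    fix \<Lambda> and \<Psi> :: "nat \<Rightarrow> 'a set" and \<sigma> \<tau>
    assume \<Lambda>: "finite \<Lambda>" "\<Lambda> \<subseteq> verts G"
      and seq: "\<forall>n. finite (\<Psi> n) \<and> \<Lambda> \<subseteq> \<Psi> n \<and> \<Psi> n \<subseteq> verts G \<and>
            boundary_condition G (\<Psi> n) (\<sigma> n) \<and> boundary_condition G (\<Psi> n) (\<tau> n)"
      and lim: "(\<lambda>n. graph_dist G \<Lambda> (boundary G (\<Psi> n))) \<longlonglongrightarrow> \<infinity>"
    let ?tv = "\<lambda>n. tv_dist_on \<Lambda> (hc_pmf G lam (\<Psi> n) (\<sigma> n)) (hc_pmf G lam (\<Psi> n) (\<tau> n))"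
    show "?tv \<longlonglongrightarrow> 0"
    proof (rule tendstoI)
      fix e :: real assume e: "e > 0"
      \<comment> \<open>The total variation distance is bounded by a sum over the subsets of
        \<open>\<Lambda>\<close>; this choice makes the sum at most \<open>e / 2\<close>, the half
        securing strictness.\<close>
      define \<epsilon> where "\<epsilon> = e / (2 * card (Pow \<Lambda>))"
      have cpos: "card (Pow \<Lambda>) > 0" using \<Lambda>(1) by (simp add: card_Pow)
      then have "\<epsilon> > 0" using e by (simp add: \<epsilon>_def)
      with R \<Lambda> obtain r where r: "insensitive_beyond G lam \<Lambda> \<epsilon> r" by blast
      have "\<forall>\<^sub>F n in sequentially. enat r < graph_dist G \<Lambda> (boundary G (\<Psi> n))"
        using lim by (rule order_tendstoD) simp
      then show "\<forall>\<^sub>F n in sequentially. dist (?tv n) 0 < e"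
      proof eventually_elim
        case (elim n)
        let ?p = "\<lambda>\<sigma>. map_pmf (\<lambda>S. S \<inter> \<Lambda>) (hc_pmf G lam (\<Psi> n) \<sigma>)"
        have gap: "small_gap G lam \<Lambda> (\<Psi> n) \<epsilon>"
          using r seq elim by (simp add: insensitive_beyond_def less_graph_dist_iff)
        have "?tv n \<le> (\<Sum>A\<in>Pow \<Lambda>. \<bar>pmf (?p (\<sigma> n)) A - pmf (?p (\<tau> n)) A\<bar>)"
          unfolding tv_dist_on_def using \<Lambda>(1) by (intro tv_dist_le_sum_pmf) auto
        also have "\<dots> \<le> (\<Sum>A\<in>Pow \<Lambda>. \<epsilon>)"
          using gap seq lam by (intro sum_mono) (auto simp: pmf_map_hc_pmf small_gap_def less_imp_le)
        also have "\<dots> = e / 2" using cpos by (auto simp: \<epsilon>_def)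
        finally have "?tv n < e" using e by simp
        moreover have "?tv n \<ge> 0"
          unfolding tv_dist_on_def using tv_dist_ge_pmf[of "?p (\<sigma> n)" "{}" "?p (\<tau> n)"] by linarith
        ultimately show ?case by simp
      qed
    qed
  qed
qed


section \<open>The spatial Markov property\<close>

lemma indep_set_mono: "indep_set G S \<Longrightarrow> R \<subseteq> S \<Longrightarrow> indep_set G R"
  by (auto simp: indep_set_def)

lemma hc_weight_eq_sum_if:
  assumes "finite \<Psi>"
  shows "hc_weight G lam \<Psi> \<sigma> \<Lambda> A =
    (\<Sum>S\<in>hc_configs G \<Psi> \<sigma>. if S \<inter> \<Lambda> = A then lam ^ card S else 0)"
  using finite_hc_configs[OF assms, of G \<sigma>]
  by (simp add: hc_weight_def sum.If_cases Int_def)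

text \<open>
  The spatial Markov property: given the occupied boundary vertices of \<open>\<Psi>0\<close> and the
  configuration \<open>R\<close> outside, the configuration inside \<open>\<Psi>0\<close> is hard-core distributed.
\<close>

lemma hc_weight_spatial_markov:
  fixes G :: "'a graph" and \<sigma> :: "'a set"
  assumes fin: "finite \<Psi>" and \<Psi>0: "\<Psi>0 \<subseteq> \<Psi>" and \<Lambda>: "\<Lambda> \<subseteq> \<Psi>0"
  defines "K \<equiv> (\<lambda>S. (S \<inter> boundary G \<Psi>0, S - \<Psi>0)) ` hc_configs G \<Psi> \<sigma>"
  shows "hc_weight G lam \<Psi> \<sigma> \<Lambda> A =
    (\<Sum>(\<sigma>0, R)\<in>K. lam ^ card R * hc_weight G lam \<Psi>0 \<sigma>0 \<Lambda> A)"
proof -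
  let ?C = "hc_configs G \<Psi> \<sigma>" and ?h = "\<lambda>S. (S \<inter> boundary G \<Psi>0, S - \<Psi>0)"
  let ?g = "\<lambda>S. if S \<inter> \<Lambda> = A then lam ^ card S else 0"
  have fin0: "finite \<Psi>0" using fin \<Psi>0 by (rule rev_finite_subset)
  \<comment> \<open>The part of \<open>\<sigma>\<close> inside \<open>\<Psi>0\<close> is thus
    already recorded in the trace on \<open>boundary G \<Psi>0\<close>, so no constraint from
    \<open>\<sigma>\<close> survives in the interior of \<open>\<Psi>0\<close>.\<close>
  have bd: "\<Psi>0 \<inter> boundary G \<Psi> \<subseteq> boundary G \<Psi>0" using \<Psi>0 by (rule boundary_mono)
  have "hc_weight G lam \<Psi> \<sigma> \<Lambda> A = (\<Sum>k\<in>K. \<Sum>S\<in>{S \<in> ?C. ?h S = k}. ?g S)"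
    unfolding hc_weight_eq_sum_if[OF fin] K_def using finite_hc_configs[OF fin] by (rule sum.image_gen)
  also have "\<dots> = (\<Sum>(\<sigma>0, R)\<in>K. lam ^ card R * hc_weight G lam \<Psi>0 \<sigma>0 \<Lambda> A)"
  proof (rule sum.cong[OF refl], clarify)
    fix \<sigma>0 R assume "(\<sigma>0, R) \<in> K"
    then obtain S1 where S1: "S1 \<in> ?C" "\<sigma>0 = S1 \<inter> boundary G \<Psi>0" "R = S1 - \<Psi>0"
      by (auto simp: K_def)
    have finR: "finite R" using S1 fin by (auto simp: hc_configs_def intro: finite_subset)
    \<comment> \<open>The boundary shields the inside from the outside: an edge from
      \<open>S0\<close> to \<open>R\<close> starts at a boundary vertex of \<open>\<Psi>0\<close>,
      where \<open>S0\<close> agrees with \<open>S1\<close>, so both its ends would lie in the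
      independent set \<open>S1\<close>.\<close>
    have glue: "S0 \<union> R \<in> ?C" if S0: "S0 \<in> hc_configs G \<Psi>0 \<sigma>0" for S0
    proof -
      have sub: "S0 \<subseteq> \<Psi>0" "indep_set G S0" "S0 \<inter> boundary G \<Psi>0 = \<sigma>0"
        using S0 by (auto simp: hc_configs_def)
      have S1': "S1 \<subseteq> \<Psi>" "indep_set G S1" "S1 \<inter> boundary G \<Psi> = \<sigma>"
        using S1 by (auto simp: hc_configs_def)
      have "\<not> adj G u v" if "u \<in> S0" "v \<in> R" for u v
      proof
        assume uv: "adj G u v"
        then have "u \<in> boundary G \<Psi>0" using that sub S1 by (auto simp: boundary_def)
        then have "u \<in> S1" using that sub S1 by auto
        then show False using S1' S1 that uv by (auto simp: indep_set_def)
      qed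
      then have "indep_set G (S0 \<union> R)"
        using sub(2) S1'(2) S1(3) adj_commute[of G] unfolding indep_set_def by blast
      moreover have "(S0 \<union> R) \<inter> boundary G \<Psi> = \<sigma>"
        using sub S1' S1 bd \<Psi>0 by blast
      ultimately show ?thesis using sub S1' S1 \<Psi>0 by (auto simp: hc_configs_def)
    qed
    have "(\<Sum>S\<in>{S \<in> ?C. ?h S = (\<sigma>0, R)}. ?g S) =
        (\<Sum>S0\<in>hc_configs G \<Psi>0 \<sigma>0. lam ^ card R * ?g S0)"
    proof (rule sum.reindex_bij_witness[of _ "\<lambda>S0. S0 \<union> R" "\<lambda>S. S \<inter> \<Psi>0"], goal_cases)
      case (1 S) then show ?case by auto
    next
      case (2 S)
      then show ?case by (auto simp: hc_configs_def boundary_def intro: indep_set_mono)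
    next
      case (3 S0) then show ?case using S1 by (auto simp: hc_configs_def)
    next
      case (4 S0)
      then show ?case using glue[OF 4] S1 by (auto simp: hc_configs_def boundary_def)
    next
      case (5 S)
      then have "card S = card (S \<inter> \<Psi>0) + card R"
        using fin by (subst card_Un_disjoint[symmetric])
          (auto simp: hc_configs_def intro: finite_subset intro!: arg_cong[where f = card])
      moreover have "S \<inter> \<Psi>0 \<inter> \<Lambda> = S \<inter> \<Lambda>" using \<Lambda> by auto
      ultimately show ?case by (simp add: power_add)
    qed
    then show "(\<Sum>S\<in>{S \<in> ?C. ?h S = (\<sigma>0, R)}. ?g S) = lam ^ card R * hc_weight G lam \<Psi>0 \<sigma>0 \<Lambda> A"
      by (simp add: hc_weight_eq_sum_if[OF fin0] sum_distrib_left)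
  qed
  finally show ?thesis .
qed

text \<open>
  Hence a marginal in \<open>\<Psi>\<close> is a convex combination of marginals in \<open>\<Psi>0\<close>.
\<close>

lemma small_gap_mono:
  assumes lam: "lam > 0" and fin: "finite \<Psi>" and \<Psi>0: "\<Psi>0 \<subseteq> \<Psi>" and \<Lambda>: "\<Lambda> \<subseteq> \<Psi>0"
    and gap: "small_gap G lam \<Lambda> \<Psi>0 \<epsilon>"
  shows "small_gap G lam \<Lambda> \<Psi> \<epsilon>"
  unfolding small_gap_def
proof (intro allI impI)
  fix \<sigma> \<tau> A assume bc: "boundary_condition G \<Psi> \<sigma>" "boundary_condition G \<Psi> \<tau>"
  define B where "B = {\<sigma>0. boundary_condition G \<Psi>0 \<sigma>0}"
  define M where "M = (\<lambda>\<sigma>0. hc_marginal G lam \<Psi>0 \<sigma>0 \<Lambda> A) ` B"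
  have fin0: "finite \<Psi>0" using fin \<Psi>0 by (rule rev_finite_subset)
  have "finite B" using finite_boundary[OF fin0, of G]
    by (intro finite_subset[of B "Pow (boundary G \<Psi>0)"]) (auto simp: B_def boundary_condition_def)
  then have finM: "finite M" by (simp add: M_def)
  have "{} \<in> B" by (auto simp: B_def boundary_condition_def indep_set_def)
  then have "M \<noteq> {}" by (auto simp: M_def)
  \<comment> \<open>\<open>Min M\<close> and \<open>Max M\<close> are attained by boundary
    conditions of \<open>\<Psi>0\<close>, to which \<open>gap\<close> applies. Attainment on a
    finite set preserves the strict inequality.\<close>
  have between: "Min M \<le> hc_marginal G lam \<Psi> \<sigma> \<Lambda> A \<and> hc_marginal G lam \<Psi> \<sigma> \<Lambda> A \<le> Max M"
    if bc: "boundary_condition G \<Psi> \<sigma>" for \<sigma>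
  proof -
    define K where "K = (\<lambda>S. (S \<inter> boundary G \<Psi>0, S - \<Psi>0)) ` hc_configs G \<Psi> \<sigma>"
    define Z where "Z \<sigma>0 = hc_weight G lam \<Psi>0 \<sigma>0 {} {}" for \<sigma>0
    \<comment> \<open>Applied both to the weight of \<open>A\<close> and to the partition function,
      so that numerator and denominator are sums over the same \<open>K\<close> with the same
      coefficients.\<close>
    have markov: "hc_weight G lam \<Psi> \<sigma> \<Lambda>' A' = (\<Sum>(\<sigma>0, R)\<in>K. lam ^ card R * hc_weight G lam \<Psi>0 \<sigma>0 \<Lambda>' A')"
      if "\<Lambda>' \<subseteq> \<Psi>0" for \<Lambda>' A'
      unfolding K_def using fin \<Psi>0 that by (rule hc_weight_spatial_markov)
    have KB: "\<sigma>0 \<in> B" if "(\<sigma>0, R) \<in> K" for \<sigma>0 R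
      using that by (auto simp: K_def B_def boundary_condition_def hc_configs_def intro: indep_set_mono)
    have Zpos: "Z \<sigma>0 > 0" if "\<sigma>0 \<in> B" for \<sigma>0
      using hc_weight_total_pos[OF lam fin0, of G \<sigma>0] that by (simp add: B_def Z_def)
    have wt: "hc_weight G lam \<Psi>0 \<sigma>0 \<Lambda> A = hc_marginal G lam \<Psi>0 \<sigma>0 \<Lambda> A * Z \<sigma>0" if "\<sigma>0 \<in> B" for \<sigma>0
      using Zpos[OF that] by (simp add: hc_marginal_def Z_def)
    have total: "hc_weight G lam \<Psi> \<sigma> {} {} = (\<Sum>(\<sigma>0, R)\<in>K. lam ^ card R * Z \<sigma>0)"
      by (simp add: markov Z_def)
    have "Min M * hc_weight G lam \<Psi> \<sigma> {} {} \<le> hc_weight G lam \<Psi> \<sigma> \<Lambda> A"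
      unfolding total markov[OF \<Lambda>] sum_distrib_left
    proof (rule sum_mono, clarify)
      fix \<sigma>0 R assume "(\<sigma>0, R) \<in> K"
      then have B: "\<sigma>0 \<in> B" by (rule KB)
      then have "Min M \<le> hc_marginal G lam \<Psi>0 \<sigma>0 \<Lambda> A" using finM by (simp add: M_def)
      then have "Min M * (lam ^ card R * Z \<sigma>0) \<le> hc_marginal G lam \<Psi>0 \<sigma>0 \<Lambda> A * (lam ^ card R * Z \<sigma>0)"
        using Zpos[OF B] lam by (intro mult_right_mono) auto
      then show "Min M * (lam ^ card R * Z \<sigma>0) \<le> lam ^ card R * hc_weight G lam \<Psi>0 \<sigma>0 \<Lambda> A"
        by (simp add: wt[OF B] ac_simps)
    qed
    moreover have "hc_weight G lam \<Psi> \<sigma> \<Lambda> A \<le> Max M * hc_weight G lam \<Psi> \<sigma> {} {}"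
      unfolding total markov[OF \<Lambda>] sum_distrib_left
    proof (rule sum_mono, clarify)
      fix \<sigma>0 R assume "(\<sigma>0, R) \<in> K"
      then have B: "\<sigma>0 \<in> B" by (rule KB)
      then have "hc_marginal G lam \<Psi>0 \<sigma>0 \<Lambda> A \<le> Max M" using finM by (simp add: M_def)
      then have "hc_marginal G lam \<Psi>0 \<sigma>0 \<Lambda> A * (lam ^ card R * Z \<sigma>0) \<le> Max M * (lam ^ card R * Z \<sigma>0)"
        using Zpos[OF B] lam by (intro mult_right_mono) auto
      then show "lam ^ card R * hc_weight G lam \<Psi>0 \<sigma>0 \<Lambda> A \<le> Max M * (lam ^ card R * Z \<sigma>0)"
        by (simp add: wt[OF B] ac_simps)
    qed
    ultimately show ?thesis
      using hc_weight_total_pos[OF lam fin bc] by (simp add: hc_marginal_def field_simps)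
  qed
  obtain \<sigma>0 where "\<sigma>0 \<in> B" "Max M = hc_marginal G lam \<Psi>0 \<sigma>0 \<Lambda> A"
    using Max_in[OF finM \<open>M \<noteq> {}\<close>] by (auto simp: M_def)
  moreover obtain \<tau>0 where "\<tau>0 \<in> B" "Min M = hc_marginal G lam \<Psi>0 \<tau>0 \<Lambda> A"
    using Min_in[OF finM \<open>M \<noteq> {}\<close>] by (auto simp: M_def)
  ultimately have "\<bar>Max M - Min M\<bar> < \<epsilon>" using gap by (simp add: small_gap_def B_def)
  with between[OF bc(1)] between[OF bc(2)]
  show "\<bar>hc_marginal G lam \<Psi> \<sigma> \<Lambda> A - hc_marginal G lam \<Psi> \<tau> \<Lambda> A\<bar> < \<epsilon>" by linarith
qed

text \<open>Every volume whose boundary avoids the \<open>r\<close>-ball contains the ball of radius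
  \<open>Suc r\<close>, hence \<open>\<Psi>0\<close>. A check in the single volume
  \<open>\<Psi>0\<close>, which need not be a ball itself, therefore certifies the radius
  \<open>r\<close>.\<close>

lemma insensitive_beyondI:
  assumes "lam > 0" "\<Lambda> \<subseteq> \<Psi>0" "\<Psi>0 \<subseteq> graph_ball G \<Lambda> (Suc r)" "small_gap G lam \<Lambda> \<Psi>0 \<epsilon>"
  shows "insensitive_beyond G lam \<Lambda> \<epsilon> r"
  unfolding insensitive_beyond_def
proof (intro allI impI)
  fix \<Psi> assume \<Psi>: "finite \<Psi>" "\<Lambda> \<subseteq> \<Psi>" "graph_ball G \<Lambda> r \<inter> boundary G \<Psi> = {}"
  have "\<Psi>0 \<subseteq> \<Psi>"
    using assms(3) graph_ball_subset_if_disjoint_boundary[OF \<Psi>(2,3)] by (rule order_trans)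
  with assms(1) \<Psi>(1) show "small_gap G lam \<Lambda> \<Psi> \<epsilon>"
    using assms(2,4) by (rule small_gap_mono)
qed

section \<open>Locality, and mixing on finite graphs\<close>

lemma small_gap_if_boundary_empty:
  assumes "boundary G \<Psi> = {}" "\<epsilon> > 0"
  shows "small_gap G lam \<Lambda> \<Psi> \<epsilon>"
  using assms by (auto simp: small_gap_def boundary_condition_def)

text \<open>Boundaries get a hypothesis of their own because they depend on edges leaving
  \<open>\<Psi>\<close>, which agreement inside \<open>\<Psi>\<close> does not control.\<close>

lemma hc_configs_cong:
  assumes "\<And>u v. u \<in> \<Psi> \<Longrightarrow> v \<in> \<Psi> \<Longrightarrow> adj G u v \<longleftrightarrow> adj H u v"
    and "verts G \<inter> \<Psi> = verts H \<inter> \<Psi>" and "boundary G \<Psi> = boundary H \<Psi>"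
  shows "hc_configs G \<Psi> \<sigma> = hc_configs H \<Psi> \<sigma>"
    and "boundary_condition G \<Psi> \<sigma> \<longleftrightarrow> boundary_condition H \<Psi> \<sigma>"
proof -
  have indep: "indep_set G S \<longleftrightarrow> indep_set H S" if "S \<subseteq> \<Psi>" for S
  proof -
    have "S \<subseteq> verts G \<longleftrightarrow> S \<subseteq> verts H" using assms(2) that by blast
    moreover have "(\<forall>u\<in>S. \<forall>v\<in>S. \<not> adj G u v) \<longleftrightarrow> (\<forall>u\<in>S. \<forall>v\<in>S. \<not> adj H u v)"
      using assms(1) that by blast
    ultimately show ?thesis by (simp add: indep_set_def)
  qed
  then show "hc_configs G \<Psi> \<sigma> = hc_configs H \<Psi> \<sigma>"
    by (auto simp: hc_configs_def assms(3))
  have "boundary H \<Psi> \<subseteq> \<Psi>" by (auto simp: boundary_def)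
  then show "boundary_condition G \<Psi> \<sigma> \<longleftrightarrow> boundary_condition H \<Psi> \<sigma>"
    using indep[of \<sigma>] by (auto simp: boundary_condition_def assms(3))
qed

lemma small_gap_cong:
  assumes "\<And>u v. u \<in> \<Psi> \<Longrightarrow> v \<in> \<Psi> \<Longrightarrow> adj G u v \<longleftrightarrow> adj H u v"
    and "verts G \<inter> \<Psi> = verts H \<inter> \<Psi>" and "boundary G \<Psi> = boundary H \<Psi>"
  shows "small_gap G lam \<Lambda> \<Psi> \<epsilon> \<longleftrightarrow> small_gap H lam \<Lambda> \<Psi> \<epsilon>"
  using hc_configs_cong[OF assms] by (simp add: small_gap_def hc_marginal_def hc_weight_def)

text \<open>In a finite graph the balls around \<open>\<Lambda>\<close> stop growing. A ball that
  has stopped growing has no edge leaving it, so its boundary is empty and \<open>{}\<close> is its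
  only boundary condition.\<close>

lemma weak_spatial_mixing_finite:
  assumes "lam > 0" "simple_graph G" "finite (verts G)"
  shows "weak_spatial_mixing G lam"
  unfolding weak_spatial_mixing_iff[OF assms(1)]
proof (intro allI impI)
  fix \<Lambda> and \<epsilon> :: real assume \<Lambda>: "finite \<Lambda>" "\<Lambda> \<subseteq> verts G" and \<epsilon>: "\<epsilon> > 0"
  have "\<exists>r. graph_ball G \<Lambda> (Suc r) = graph_ball G \<Lambda> r"
  proof (rule ccontr)
    assume "\<nexists>r. graph_ball G \<Lambda> (Suc r) = graph_ball G \<Lambda> r"
    then have "graph_ball G \<Lambda> r \<subset> graph_ball G \<Lambda> (Suc r)" for r
      using graph_ball_mono[of r "Suc r" G \<Lambda>] by auto
    then have "strict_mono (graph_ball G \<Lambda>)" by (simp add: strict_mono_Suc_iff)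
    then have "inj (graph_ball G \<Lambda>)" by (rule strict_mono_imp_inj_on)
    moreover have "range (graph_ball G \<Lambda>) \<subseteq> Pow (verts G)"
      using graph_ball_subset_verts[OF assms(2) \<Lambda>(2)] by auto
    ultimately have "finite (UNIV :: nat set)"
      using assms(3) by (meson finite_Pow_iff finite_imageD finite_subset)
    then show False by simp
  qed
  then obtain r where r: "graph_ball G \<Lambda> (Suc r) = graph_ball G \<Lambda> r" ..
  have "boundary G (graph_ball G \<Lambda> (Suc r)) = {}"
  proof -
    have "boundary G (graph_ball G \<Lambda> (Suc r)) \<subseteq> graph_ball G \<Lambda> (Suc r)"
      by (auto simp: boundary_def)
    then show ?thesis using graph_ball_disjoint_boundary[of G \<Lambda> r] r by blast
  qed
  then have "small_gap G lam \<Lambda> (graph_ball G \<Lambda> (Suc r)) \<epsilon>"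
    using \<epsilon> by (rule small_gap_if_boundary_empty)
  with assms(1) subset_graph_ball order_refl have "insensitive_beyond G lam \<Lambda> \<epsilon> r"
    by (rule insensitive_beyondI)
  then show "\<exists>r. insensitive_beyond G lam \<Lambda> \<epsilon> r" ..
qed

text \<open>
  Once the separating set \<open>K\<close> is unoccupied, the copy \<open>f ` \<Psi>\<close> is independent of the rest \<open>U\<close>.
\<close>

lemma hc_weight_embedding:
  fixes f :: "'a \<Rightarrow> 'b" and G' :: "'b graph" and lam :: real
  assumes inj: "inj f" and fin: "finite \<Psi>" "finite U"
    and adj: "\<And>u v. adj G' (f u) (f v) \<longleftrightarrow> adj G u v"
    and verts: "\<And>u. u \<in> \<Psi> \<Longrightarrow> f u \<in> verts G' \<longleftrightarrow> u \<in> verts G"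
    and disj: "f ` \<Psi> \<inter> U = {}" "f ` \<Psi> \<inter> K = {}" "K \<inter> U = {}"
    and sep: "\<And>u v. u \<in> \<Psi> \<Longrightarrow> v \<in> U \<Longrightarrow> \<not> adj G' (f u) v"
    and bd: "f ` \<Psi> \<inter> boundary G' (f ` \<Psi> \<union> K \<union> U) = f ` boundary G \<Psi>"
      "K \<inter> boundary G' (f ` \<Psi> \<union> K \<union> U) = {}"
    and \<sigma>: "\<sigma> \<subseteq> \<Psi>" and \<Lambda>: "\<Lambda> \<subseteq> \<Psi>" and A: "A \<subseteq> \<Lambda>"
  defines "W \<equiv> (\<Sum>R | R \<subseteq> U \<and> indep_set G' R \<and> R \<inter> boundary G' (f ` \<Psi> \<union> K \<union> U) = {}. lam ^ card R)"
  shows "hc_weight G' lam (f ` \<Psi> \<union> K \<union> U) (f ` \<sigma>) (f ` \<Lambda> \<union> K) (f ` A) = W * hc_weight G lam \<Psi> \<sigma> \<Lambda> A"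
proof -
  let ?\<Psi> = "f ` \<Psi> \<union> K \<union> U"
  define R where "R = {R. R \<subseteq> U \<and> indep_set G' R \<and> R \<inter> boundary G' ?\<Psi> = {}}"
  define C where "C = {S. S \<in> hc_configs G \<Psi> \<sigma> \<and> S \<inter> \<Lambda> = A}"
  define C' where "C' = {S. S \<in> hc_configs G' ?\<Psi> (f ` \<sigma>) \<and> S \<inter> (f ` \<Lambda> \<union> K) = f ` A}"
  have indep: "indep_set G' (f ` S) \<longleftrightarrow> indep_set G S" if "S \<subseteq> \<Psi>" for S
  proof -
    have "f ` S \<subseteq> verts G' \<longleftrightarrow> S \<subseteq> verts G"
      using that verts unfolding image_subset_iff by blast
    then show ?thesis by (simp add: indep_set_def adj)
  qed
  have "W * hc_weight G lam \<Psi> \<sigma> \<Lambda> A = (\<Sum>r\<in>R. \<Sum>S\<in>C. lam ^ card r * lam ^ card S)"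
    by (simp add: W_def hc_weight_def R_def C_def sum_product)
  also have "\<dots> = (\<Sum>(r, S)\<in>R \<times> C. lam ^ card r * lam ^ card S)"
    by (rule sum.cartesian_product)
  \<comment> \<open>The trace \<open>f\<close>
    A\<open>contains no point of\<close>K\<open>, so\<close>K\<open>is vacant, and no edge joins the copy of\<close>\<Psi>\<open>to\<close>U\<open>. A configuration is therefore a free choice of its part\<close>r\<open>in\<close>U\<open>and its part\<close>f
    \<open>S\<close> in the copy.\<close>
  also have "\<dots> = (\<Sum>S\<in>C'. lam ^ card S)"
  proof (rule sum.reindex_bij_witness[of _ "\<lambda>S. (S \<inter> U, f -` S \<inter> \<Psi>)" "\<lambda>(r, S). f ` S \<union> r"], goal_cases)
    case (1 a)
    obtain r S where a: "a = (r, S)" by (cases a)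
    then have "r \<subseteq> U" "S \<subseteq> \<Psi>" using 1 by (auto simp: R_def C_def hc_configs_def)
    then have "(f ` S \<union> r) \<inter> U = r" "f -` (f ` S \<union> r) \<inter> \<Psi> = S"
      using disj(1) inj by (auto simp: inj_def)
    then show ?case by (simp add: a)
  next
    case (2 a)
    obtain r S where a: "a = (r, S)" by (cases a)
    then have r: "r \<subseteq> U" "indep_set G' r" "r \<inter> boundary G' ?\<Psi> = {}"
      and S: "S \<subseteq> \<Psi>" "indep_set G S" "S \<inter> boundary G \<Psi> = \<sigma>" "S \<inter> \<Lambda> = A"
      using 2 by (auto simp: R_def C_def hc_configs_def)
    have "indep_set G' (f ` S \<union> r)"
    proof -
      have "indep_set G' (f ` S)" using S indep by simp
      moreover have "\<not> adj G' u v \<and> \<not> adj G' v u" if "u \<in> f ` S" "v \<in> r" for u v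
        using that sep S(1) r(1) adj_commute[of G'] by blast
      ultimately show ?thesis using r(2) unfolding indep_set_def by blast
    qed
    moreover have "f ` S \<inter> boundary G' ?\<Psi> = f ` \<sigma>"
    proof -
      have "f ` S \<inter> boundary G' ?\<Psi> = f ` S \<inter> (f ` \<Psi> \<inter> boundary G' ?\<Psi>)" using S(1) by blast
      also have "\<dots> = f ` (S \<inter> boundary G \<Psi>)" unfolding bd(1) using inj by (simp only: image_Int)
      finally show ?thesis using S by simp
    qed
    moreover have "(f ` S \<union> r) \<inter> (f ` \<Lambda> \<union> K) = f ` A"
    proof -
      have "(f ` S \<union> r) \<inter> (f ` \<Lambda> \<union> K) = f ` S \<inter> f ` \<Lambda>" using disj r(1) S(1) \<Lambda> by blast
      then show ?thesis using S(4) inj image_Int[of f S \<Lambda>] by simp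
    qed
    ultimately show ?case using r S a by (auto simp: C'_def hc_configs_def)
  next
    case (3 S)
    then have "S \<inter> K \<subseteq> f ` \<Psi>" using A \<Lambda> unfolding C'_def by blast
    then have "S \<inter> K = {}" using disj(2) by blast
    then show ?case using 3 by (auto simp: C'_def hc_configs_def)
  next
    case (4 S)
    then have S: "S \<subseteq> ?\<Psi>" "indep_set G' S" "S \<inter> boundary G' ?\<Psi> = f ` \<sigma>" "S \<inter> (f ` \<Lambda> \<union> K) = f ` A"
      by (auto simp: C'_def hc_configs_def)
    let ?S = "f -` S \<inter> \<Psi>"
    have f_iff: "f u \<in> f ` X \<longleftrightarrow> u \<in> X" for u X using inj by (rule inj_image_mem_iff)
    have "indep_set G ?S"
      using indep[of ?S] indep_set_mono[OF S(2), of "f ` ?S"] by auto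
    moreover have "?S \<inter> boundary G \<Psi> = \<sigma>"
    proof (rule set_eqI)
      fix u
      have "u \<in> ?S \<inter> boundary G \<Psi> \<longleftrightarrow> u \<in> \<Psi> \<and> f u \<in> S \<and> f u \<in> f ` \<Psi> \<inter> boundary G' ?\<Psi>"
        unfolding bd(1) f_iff by auto
      also have "\<dots> \<longleftrightarrow> u \<in> \<Psi> \<and> f u \<in> f ` \<sigma>" unfolding S(3)[symmetric] by auto
      also have "\<dots> \<longleftrightarrow> u \<in> \<sigma>" using \<sigma> by (auto simp: f_iff)
      finally show "u \<in> ?S \<inter> boundary G \<Psi> \<longleftrightarrow> u \<in> \<sigma>" .
    qed
    moreover have "?S \<inter> \<Lambda> = A"
    proof (rule set_eqI)
      fix u
      have "u \<in> ?S \<inter> \<Lambda> \<longleftrightarrow> u \<in> \<Lambda> \<and> f u \<in> S \<inter> (f ` \<Lambda> \<union> K)" using \<Lambda> by auto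
      also have "\<dots> \<longleftrightarrow> u \<in> A" unfolding S(4) f_iff using A by auto
      finally show "u \<in> ?S \<inter> \<Lambda> \<longleftrightarrow> u \<in> A" .
    qed
    moreover have "S \<inter> U \<inter> boundary G' ?\<Psi> = {}"
      using S(3) \<sigma> disj(1) by blast
    ultimately show ?case
      using S(2) by (auto simp: R_def C_def hc_configs_def intro: indep_set_mono)
  next
    case (5 a)
    obtain r S where a: "a = (r, S)" by (cases a)
    have sub: "r \<subseteq> U" "S \<subseteq> \<Psi>" using 5 a by (auto simp: R_def C_def hc_configs_def)
    have "card (f ` S \<union> r) = card (f ` S) + card r"
      using sub fin disj(1) by (intro card_Un_disjoint) (auto intro: finite_subset)
    also have "card (f ` S) = card S"
      using inj by (intro card_image) (auto intro: inj_on_subset)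
    finally have "card (f ` S \<union> r) = card S + card r" .
    then show ?case using a by (simp add: power_add)
  qed
  finally show ?thesis by (simp add: C'_def hc_weight_def)
qed


section \<open>Relabelling and compactness\<close>

text \<open>Applied with \<open>f = Cons i\<close>, which carries subgraphs of a child's subtree to
  subgraphs of the whole tree.\<close>

definition map_graph :: "('a \<Rightarrow> 'b) \<Rightarrow> 'a graph \<Rightarrow> 'b graph" where
  "map_graph f G = (f ` verts G, (`) f ` edges G)"

lemma verts_map_graph: "verts (map_graph f G) = f ` verts G"
  by (simp add: map_graph_def)

lemma adj_map_graph: "inj f \<Longrightarrow> adj (map_graph f G) (f u) (f v) \<longleftrightarrow> adj G u v"
proof -
  assume "inj f"
  have "{f u, f v} = f ` {u, v}" by simp
  also have "\<dots> \<in> (`) f ` edges G \<longleftrightarrow> {u, v} \<in> edges G"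
    using \<open>inj f\<close> by (auto simp: inj_image_eq_iff image_iff simp del: image_insert)
  finally show ?thesis by (simp add: adj_def map_graph_def)
qed

lemma adj_map_graph_range:
  assumes "adj (map_graph f G) x y"
  shows "x \<in> range f" "y \<in> range f"
proof -
  obtain e where "{x, y} = f ` e" using assms by (auto simp: adj_def map_graph_def)
  then show "x \<in> range f" "y \<in> range f" by blast+
qed

lemma graph_ball_map_graph:
  assumes "inj f"
  shows "graph_ball (map_graph f G) (f ` \<Lambda>) r = f ` graph_ball G \<Lambda> r"
proof (induction r)
  case (Suc r)
  have "{y. \<exists>x\<in>f ` graph_ball G \<Lambda> r. adj (map_graph f G) x y} =
      f ` {v. \<exists>u\<in>graph_ball G \<Lambda> r. adj G u v}"
    using adj_map_graph_range(2)[of f G] adj_map_graph[OF assms, of G] by fast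
  then show ?case by (simp add: Suc.IH image_Un)
qed simp

lemma boundary_map_graph:
  assumes "inj f"
  shows "boundary (map_graph f G) (f ` \<Psi>) = f ` boundary G \<Psi>"
proof (intro set_eqI iffI)
  fix x assume "x \<in> boundary (map_graph f G) (f ` \<Psi>)"
  then obtain u y where u: "u \<in> \<Psi>" "x = f u" "adj (map_graph f G) x y" "y \<notin> f ` \<Psi>"
    by (auto simp: boundary_def)
  then obtain v where "y = f v" using adj_map_graph_range(2)[OF u(3)] by blast
  then show "x \<in> f ` boundary G \<Psi>"
    using u by (auto simp: boundary_def adj_map_graph[OF assms])
next
  fix x assume "x \<in> f ` boundary G \<Psi>"
  then obtain u v where "u \<in> \<Psi>" "x = f u" "adj G u v" "v \<notin> \<Psi>"
    by (auto simp: boundary_def)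
  then have "x \<in> f ` \<Psi>" "adj (map_graph f G) x (f v)" "f v \<notin> f ` \<Psi>"
    using assms by (simp_all add: adj_map_graph inj_image_mem_iff)
  then show "x \<in> boundary (map_graph f G) (f ` \<Psi>)"
    by (auto simp: boundary_def)
qed

lemma simple_graph_map_graph:
  assumes "inj f" "simple_graph G" shows "simple_graph (map_graph f G)"
proof -
  have "card (f ` e) = card e" for e
    using assms(1) by (intro card_image) (auto intro: inj_on_subset)
  then show ?thesis using assms(2) by (fastforce simp: simple_graph_def map_graph_def)
qed

lemma boundary_condition_map_graph:
  assumes "inj f"
  shows "boundary_condition (map_graph f G) (f ` \<Psi>) (f ` \<sigma>) \<longleftrightarrow> boundary_condition G \<Psi> \<sigma>"
proof -
  have "indep_set (map_graph f G) (f ` \<sigma>) \<longleftrightarrow> indep_set G \<sigma>"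
    using assms by (simp add: indep_set_def adj_map_graph verts_map_graph inj_image_subset_iff)
  then show ?thesis
    using assms by (simp add: boundary_condition_def boundary_map_graph inj_image_subset_iff)
qed

lemma hc_marginal_not_subset: "\<not> A \<subseteq> \<Lambda> \<Longrightarrow> hc_marginal G lam \<Psi> \<sigma> \<Lambda> A = 0"
  by (auto simp: hc_marginal_def hc_weight_def intro!: sum.neutral)

text \<open>The embedding lemma with nothing outside the copy: for empty \<open>K\<close> and
  \<open>U\<close> the factor \<open>W\<close> counts the empty configuration alone and equals
  1.\<close>

lemma hc_weight_map_graph:
  assumes "inj f" "finite \<Psi>" "\<sigma> \<subseteq> \<Psi>" "\<Lambda> \<subseteq> \<Psi>" "A \<subseteq> \<Lambda>"
  shows "hc_weight (map_graph f G) lam (f ` \<Psi>) (f ` \<sigma>) (f ` \<Lambda>) (f ` A) = hc_weight G lam \<Psi> \<sigma> \<Lambda> A"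
proof -
  let ?R = "{R. R \<subseteq> {} \<and> indep_set (map_graph f G) R \<and>
      R \<inter> boundary (map_graph f G) (f ` \<Psi> \<union> {} \<union> {}) = {}}"
  have "?R = {{}}" by (auto simp: indep_set_def)
  then have "(\<Sum>R\<in>?R. lam ^ card R) = 1" by simp
  moreover have "f ` \<Psi> \<inter> boundary (map_graph f G) (f ` \<Psi>) = f ` boundary G \<Psi>"
    unfolding boundary_map_graph[OF assms(1)] by (auto simp: boundary_def)
  moreover have "f u \<in> verts (map_graph f G) \<longleftrightarrow> u \<in> verts G" for u
    using assms(1) by (simp add: map_graph_def inj_image_mem_iff)
  ultimately show ?thesis
    using hc_weight_embedding[of f \<Psi> "{}" "map_graph f G" G "{}" \<sigma> \<Lambda> A lam] assms
    by (simp add: adj_map_graph)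
qed

lemma small_gap_map_graph:
  assumes f: "inj f" and fin: "finite \<Psi>" and \<Lambda>: "\<Lambda> \<subseteq> \<Psi>" and \<epsilon>: "\<epsilon> > 0"
    and gap: "small_gap (map_graph f G) lam (f ` \<Lambda>) (f ` \<Psi>) \<epsilon>"
  shows "small_gap G lam \<Lambda> \<Psi> \<epsilon>"
  unfolding small_gap_def
proof (intro allI impI)
  fix \<sigma> \<tau> A assume bc: "boundary_condition G \<Psi> \<sigma>" "boundary_condition G \<Psi> \<tau>"
  have eq: "hc_marginal (map_graph f G) lam (f ` \<Psi>) (f ` \<sigma>) (f ` \<Lambda>) (f ` A) = hc_marginal G lam \<Psi> \<sigma> \<Lambda> A"
    if "boundary_condition G \<Psi> \<sigma>" "A \<subseteq> \<Lambda>" for \<sigma>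
  proof -
    have "\<sigma> \<subseteq> \<Psi>" using that by (auto simp: boundary_condition_def boundary_def)
    then show ?thesis
      using hc_weight_map_graph[OF f fin _ \<Lambda>, of \<sigma> A G lam] that
        hc_weight_map_graph[OF f fin, of \<sigma> "{}" "{}" G lam]
      by (simp add: hc_marginal_def)
  qed
  show "\<bar>hc_marginal G lam \<Psi> \<sigma> \<Lambda> A - hc_marginal G lam \<Psi> \<tau> \<Lambda> A\<bar> < \<epsilon>"
  proof (cases "A \<subseteq> \<Lambda>")
    case True
    have "boundary_condition (map_graph f G) (f ` \<Psi>) (f ` \<sigma>)"
      "boundary_condition (map_graph f G) (f ` \<Psi>) (f ` \<tau>)"
      using bc f by (simp_all add: boundary_condition_map_graph)
    with gap have "\<bar>hc_marginal (map_graph f G) lam (f ` \<Psi>) (f ` \<sigma>) (f ` \<Lambda>) (f ` A) -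
        hc_marginal (map_graph f G) lam (f ` \<Psi>) (f ` \<tau>) (f ` \<Lambda>) (f ` A)\<bar> < \<epsilon>"
      unfolding small_gap_def by blast
    then show ?thesis using True bc by (simp add: eq)
  qed (simp add: hc_marginal_not_subset \<epsilon>)
qed

lemma weak_spatial_mixing_map_graph:
  assumes lam: "lam > 0" and f: "inj f" and wsm: "weak_spatial_mixing (map_graph f G) lam"
  shows "weak_spatial_mixing G lam"
  unfolding weak_spatial_mixing_iff[OF lam]
proof (intro allI impI)
  fix \<Lambda> and \<epsilon> :: real assume \<Lambda>: "finite \<Lambda>" "\<Lambda> \<subseteq> verts G" and \<epsilon>: "\<epsilon> > 0"
  then have "finite (f ` \<Lambda>)" "f ` \<Lambda> \<subseteq> verts (map_graph f G)" by (auto simp: map_graph_def)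
  with wsm \<epsilon> obtain r where r: "insensitive_beyond (map_graph f G) lam (f ` \<Lambda>) \<epsilon> r"
    unfolding weak_spatial_mixing_iff[OF lam] by meson
  have "insensitive_beyond G lam \<Lambda> \<epsilon> r"
    unfolding insensitive_beyond_def
  proof (intro allI impI)
    fix \<Psi> assume \<Psi>: "finite \<Psi>" "\<Lambda> \<subseteq> \<Psi>" "\<Psi> \<subseteq> verts G" "graph_ball G \<Lambda> r \<inter> boundary G \<Psi> = {}"
    have "graph_ball (map_graph f G) (f ` \<Lambda>) r \<inter> boundary (map_graph f G) (f ` \<Psi>) = {}"
      using \<Psi>(4) f by (simp add: graph_ball_map_graph boundary_map_graph image_Int[symmetric])
    then have "small_gap (map_graph f G) lam (f ` \<Lambda>) (f ` \<Psi>) \<epsilon>"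
      using r \<Psi>(1-3) by (simp add: insensitive_beyond_def image_mono map_graph_def)
    then show "small_gap G lam \<Lambda> \<Psi> \<epsilon>" by (rule small_gap_map_graph[OF f \<Psi>(1,2) \<epsilon>])
  qed
  then show "\<exists>r. insensitive_beyond G lam \<Lambda> \<epsilon> r" ..
qed

text \<open>Sequential compactness of the space of subsets, in its local form.\<close>

lemma local_limit_of_sets:
  fixes X :: "nat \<Rightarrow> 'a set" and F :: "nat \<Rightarrow> 'a set"
  assumes fin: "\<And>r. finite (F r)" and mono: "mono F"
  obtains L where "L \<subseteq> (\<Union>r. F r)" "\<And>r. infinite {n. X n \<inter> F r = L \<inter> F r}"
proof -
  let ?P = "\<lambda>r Z. Z \<subseteq> F r \<and> infinite {n. X n \<inter> F r = Z}"
  have pigeon: "\<exists>Z\<subseteq>F s. infinite {n \<in> N. X n \<inter> F s = Z}" if "infinite N" for N s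
  proof -
    have "finite ((\<lambda>n. X n \<inter> F s) ` N)"
      by (rule finite_subset[of _ "Pow (F s)"]) (use fin in auto)
    from pigeonhole_infinite[OF that this] show ?thesis by (meson inf_le2)
  qed
  \<comment> \<open>A Koenig argument: among the infinitely many \<open>n\<close> with trace
    \<open>Z r\<close> on \<open>F r\<close>, finitely many traces on \<open>F (Suc r)\<close> are
    possible, so one of them recurs infinitely often, and it extends \<open>Z r\<close>.\<close>
  have "\<exists>Z. \<forall>r. ?P r (Z r) \<and> Z (Suc r) \<inter> F r = Z r"
  proof (rule dependent_nat_choice)
    show "\<exists>Z. ?P 0 Z" using pigeon[of UNIV 0] by auto
  next
    fix Z r assume Z: "?P r Z"
    with pigeon obtain Y where Y: "Y \<subseteq> F (Suc r)" "infinite {n \<in> {n. X n \<inter> F r = Z}. X n \<inter> F (Suc r) = Y}"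
      by meson
    then obtain n where n: "X n \<inter> F r = Z" "X n \<inter> F (Suc r) = Y"
      using not_finite_existsD by fastforce
    have "F r \<subseteq> F (Suc r)" using mono by (simp add: monoD)
    then have "Y \<inter> F r = Z" using n by blast
    moreover have "infinite {n. X n \<inter> F (Suc r) = Y}"
      using Y(2) by (rule contrapos_nn) (auto intro: rev_finite_subset)
    ultimately show "\<exists>Y. ?P (Suc r) Y \<and> Y \<inter> F r = Z" using Y(1) by blast
  qed
  then obtain Z where Z: "\<And>r. Z r \<subseteq> F r" "\<And>r. infinite {n. X n \<inter> F r = Z r}"
    "\<And>r. Z (Suc r) \<inter> F r = Z r" by blast
  have restr: "Z (r + k) \<inter> F r = Z r" for r k
  proof (induction k)
    case 0 then show ?case using Z(1) by auto
  next
    case (Suc k)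
    have "F r \<subseteq> F (r + k)" using mono by (simp add: monoD)
    then have "Z (r + Suc k) \<inter> F r = Z (Suc (r + k)) \<inter> F (r + k) \<inter> F r" by auto
    then show ?case using Suc.IH Z(3) by simp
  qed
  have "(\<Union>s. Z s) \<inter> F r = Z r" for r
  proof (intro equalityI subsetI)
    fix x assume "x \<in> (\<Union>s. Z s) \<inter> F r"
    then obtain s where s: "x \<in> Z s" "x \<in> F r" by blast
    show "x \<in> Z r"
    proof (cases "s \<le> r")
      case True
      then show ?thesis using restr[of s "r - s"] s by auto
    next
      case False
      then show ?thesis using restr[of r "s - r"] s by auto
    qed
  qed (use Z(1) in auto)
  then show ?thesis using Z by (intro that[of "\<Union>s. Z s"]) auto
qed

lemma finite_graph_ball:
  assumes "\<And>u. finite {v. adj G u v}" "finite \<Lambda>"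
  shows "finite (graph_ball G \<Lambda> r)"
proof (induction r)
  case (Suc r)
  have "{v. \<exists>u\<in>graph_ball G \<Lambda> r. adj G u v} = (\<Union>u\<in>graph_ball G \<Lambda> r. {v. adj G u v})" by auto
  then show ?case using Suc assms(1) by simp
qed (simp add: assms)

lemma graph_ball_cong:
  assumes "graph_ball G \<Lambda> r \<subseteq> B" "graph_ball H \<Lambda> r \<subseteq> B"
    and "\<And>u v. u \<in> B \<Longrightarrow> v \<in> B \<Longrightarrow> adj G u v \<longleftrightarrow> adj H u v"
  shows "graph_ball G \<Lambda> r = graph_ball H \<Lambda> r"
  using assms(1,2)
proof (induction r)
  case (Suc r)
  then have IH: "graph_ball G \<Lambda> r = graph_ball H \<Lambda> r" by simp
  have "adj G u v \<longleftrightarrow> adj H u v" if "u \<in> graph_ball H \<Lambda> r" for u v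
    using that Suc.prems assms(3)[of u v] unfolding graph_ball.simps IH by blast
  then show ?case by (auto simp: IH)
qed simp

text \<open>
  By compactness of the space of subgraphs, mixing on every subgraph is uniform over all of them.
\<close>

lemma strong_spatial_mixing_iff:
  fixes T :: "'a graph"
  assumes lam: "lam > 0" and locfin: "\<And>u. finite {v. adj T u v}"
  shows "strong_spatial_mixing T lam \<longleftrightarrow>
    (\<forall>\<Lambda> \<epsilon>. finite \<Lambda> \<longrightarrow> \<epsilon> > 0 \<longrightarrow>
      (\<exists>r. \<forall>H. subgraph H T \<longrightarrow> finite (verts H) \<longrightarrow> \<Lambda> \<subseteq> verts H \<longrightarrow> insensitive_beyond H lam \<Lambda> \<epsilon> r))"
    (is "_ \<longleftrightarrow> ?R")
proof
  assume ?R
  show "strong_spatial_mixing T lam"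
    unfolding strong_spatial_mixing_def weak_spatial_mixing_iff[OF lam]
  proof (intro allI impI)
    fix H and \<Lambda> and \<epsilon> :: real
    assume H: "subgraph H T" and \<Lambda>: "finite \<Lambda>" "\<Lambda> \<subseteq> verts H" and \<epsilon>: "\<epsilon> > 0"
    from \<open>?R\<close> \<Lambda>(1) \<epsilon> obtain r where r: "\<And>H. subgraph H T \<Longrightarrow> finite (verts H) \<Longrightarrow> \<Lambda> \<subseteq> verts H \<Longrightarrow>
        insensitive_beyond H lam \<Lambda> \<epsilon> r" by blast
    have "insensitive_beyond H lam \<Lambda> \<epsilon> r"
      unfolding insensitive_beyond_def
    proof (intro allI impI)
      fix \<Psi> assume \<Psi>: "finite \<Psi>" "\<Lambda> \<subseteq> \<Psi>" "\<Psi> \<subseteq> verts H" "graph_ball H \<Lambda> r \<inter> boundary H \<Psi> = {}"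
      have "\<forall>v\<in>boundary H \<Psi>. \<exists>w. adj H v w \<and> w \<notin> \<Psi>" by (auto simp: boundary_def)
      then obtain g where g: "\<And>v. v \<in> boundary H \<Psi> \<Longrightarrow> adj H v (g v) \<and> g v \<notin> \<Psi>" by metis
      \<comment> \<open>A finite subgraph has to reproduce the boundary of \<open>\<Psi>\<close> in
        a possibly infinite \<open>H\<close>. Keeping one outside neighbour \<open>g v\<close> of
        each boundary vertex is enough.\<close>
      define W where "W = \<Psi> \<union> g ` boundary H \<Psi>"
      define H' where "H' = (verts H \<inter> W, {e \<in> edges H. e \<subseteq> W})"
      have finW: "finite W" using \<Psi>(1) by (simp add: W_def finite_boundary)
      have adj': "adj H' u v \<longleftrightarrow> adj H u v \<and> u \<in> W \<and> v \<in> W" for u v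
        by (auto simp: adj_def H'_def)
      have "subgraph H' T" using H by (auto simp: subgraph_def simple_graph_def H'_def)
      then have ins: "insensitive_beyond H' lam \<Lambda> \<epsilon> r"
        using \<Psi> \<Lambda> finW by (intro r) (auto simp: H'_def W_def)
      have bd: "boundary H' \<Psi> = boundary H \<Psi>"
      proof (intro equalityI subsetI)
        fix v assume v: "v \<in> boundary H \<Psi>"
        then have "v \<in> \<Psi>" by (simp add: boundary_def)
        moreover have "adj H' v (g v)" "g v \<notin> \<Psi>"
          using g[OF v] v \<open>v \<in> \<Psi>\<close> by (auto simp: adj' W_def)
        ultimately show "v \<in> boundary H' \<Psi>" by (auto simp: boundary_def)
      qed (auto simp: boundary_def adj')
      have "graph_ball H' \<Lambda> r \<subseteq> graph_ball H \<Lambda> r"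
        by (rule graph_ball_mono_graph) (simp add: adj')
      then have "graph_ball H' \<Lambda> r \<inter> boundary H' \<Psi> = {}" using \<Psi>(4) bd by blast
      then have "small_gap H' lam \<Lambda> \<Psi> \<epsilon>"
        using ins \<Psi> by (simp add: insensitive_beyond_def H'_def W_def)
      moreover have "small_gap H' lam \<Lambda> \<Psi> \<epsilon> \<longleftrightarrow> small_gap H lam \<Lambda> \<Psi> \<epsilon>"
        using \<Psi>(3) by (intro small_gap_cong bd) (auto simp: adj' W_def, auto simp: H'_def W_def)
      ultimately show "small_gap H lam \<Lambda> \<Psi> \<epsilon>" by simp
    qed
    then show "\<exists>r. insensitive_beyond H lam \<Lambda> \<epsilon> r" ..
  qed
next
  assume ssm: "strong_spatial_mixing T lam"
  show ?R
  proof (intro allI impI, rule ccontr)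
    fix \<Lambda> :: "'a set" and \<epsilon> :: real assume \<Lambda>: "finite \<Lambda>" and \<epsilon>: "\<epsilon> > 0"
    assume "\<nexists>r. \<forall>H. subgraph H T \<longrightarrow> finite (verts H) \<longrightarrow> \<Lambda> \<subseteq> verts H \<longrightarrow> insensitive_beyond H lam \<Lambda> \<epsilon> r"
    then have "\<forall>n. \<exists>H. subgraph H T \<and> \<Lambda> \<subseteq> verts H \<and> \<not> insensitive_beyond H lam \<Lambda> \<epsilon> n" by blast
    from choice[OF this] obtain H where H: "\<And>n. subgraph (H n) T" "\<And>n. \<Lambda> \<subseteq> verts (H n)"
      "\<And>n. \<not> insensitive_beyond (H n) lam \<Lambda> \<epsilon> n" by blast
    \<comment> \<open>The test volume will be the ball of radius \<open>Suc r\<close>; its boundary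
      depends on edges that reach one step further, hence \<open>r + 2\<close>.\<close>
    define B where "B r = graph_ball T \<Lambda> (r + 2)" for r
    \<comment> \<open>Vertices and edges are coded in one disjoint sum, so that a single local limit
      \<open>L\<close> yields the vertex set and the edge set of the limit graph together.\<close>
    define F where "F r = Inl ` B r \<union> Inr ` Pow (B r)" for r
    define X where "X n = Inl ` verts (H n) \<union> Inr ` edges (H n)" for n
    have finB: "finite (B r)" for r unfolding B_def using locfin \<Lambda> by (rule finite_graph_ball)
    have "mono B" unfolding B_def by (intro monoI graph_ball_mono) simp
    then have "mono F" unfolding mono_def F_def by (meson Pow_mono Un_mono image_mono)
    moreover have "finite (F r)" for r by (simp add: F_def finB)
    ultimately obtain L where L: "L \<subseteq> (\<Union>r. F r)" "\<And>r. infinite {n. X n \<inter> F r = L \<inter> F r}"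
      using local_limit_of_sets[of F X] by blast
    define G where "G = (Inl -` L, Inr -` L)"
    have agree: "\<exists>n\<ge>r. verts (H n) \<inter> B r = verts G \<inter> B r \<and>
        (\<forall>e\<subseteq>B r. e \<in> edges (H n) \<longleftrightarrow> e \<in> edges G)" for r
    proof -
      obtain n where n: "n \<ge> r" "X n \<inter> F r = L \<inter> F r"
        using L(2)[of r] unfolding infinite_nat_iff_unbounded_le by blast
      have "v \<in> verts (H n) \<longleftrightarrow> v \<in> verts G" if "v \<in> B r" for v
        using n(2) that by (auto simp: X_def F_def G_def set_eq_iff)
      moreover have "e \<in> edges (H n) \<longleftrightarrow> e \<in> edges G" if "e \<subseteq> B r" for e
        using n(2) that by (auto simp: X_def F_def G_def set_eq_iff)
      ultimately show ?thesis using n(1) by blast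
    qed
    have edge: "\<exists>n. e \<in> edges (H n) \<and> e \<subseteq> verts G" if "e \<in> edges G" for e
    proof -
      have "Inr e \<in> (\<Union>r. F r)" using that L(1) by (auto simp: G_def)
      then obtain r where r: "e \<subseteq> B r" by (auto simp: F_def)
      from agree[of r] obtain n where n: "verts (H n) \<inter> B r = verts G \<inter> B r"
        and "\<forall>e\<subseteq>B r. e \<in> edges (H n) \<longleftrightarrow> e \<in> edges G" by (elim exE conjE)
      with r that have "e \<in> edges (H n)" by simp
      moreover have "e \<subseteq> verts (H n)"
        using calculation H(1)[of n] by (auto simp: subgraph_def simple_graph_def)
      ultimately show ?thesis using n r by blast
    qed
    have vert: "\<exists>n. v \<in> verts (H n)" if "v \<in> verts G" for v
    proof -
      have "Inl v \<in> (\<Union>r. F r)" using that L(1) by (auto simp: G_def)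
      then obtain r where "v \<in> B r" by (auto simp: F_def)
      moreover from agree[of r] obtain n where "verts (H n) \<inter> B r = verts G \<inter> B r"
        by (elim exE conjE)
      ultimately show ?thesis using that by blast
    qed
    have G: "subgraph G T"
      unfolding subgraph_def simple_graph_def
      using edge vert H(1) unfolding subgraph_def simple_graph_def by (meson subset_iff)
    have \<Lambda>G: "\<Lambda> \<subseteq> verts G"
      using agree[of 0] H(2) subset_graph_ball[of \<Lambda> T 2] by (auto simp: B_def)
    obtain r where r: "insensitive_beyond G lam \<Lambda> \<epsilon> r"
      using ssm G \<Lambda> \<Lambda>G \<epsilon> unfolding strong_spatial_mixing_def weak_spatial_mixing_iff[OF lam] by meson
    let ?\<Psi> = "graph_ball G \<Lambda> (Suc r)"
    have ball_T: "graph_ball G' \<Lambda> k \<subseteq> graph_ball T \<Lambda> k" if "subgraph G' T" for G' k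
      using that by (intro graph_ball_mono_graph) (auto simp: subgraph_def adj_def)
    have "finite ?\<Psi>"
      using ball_T[OF G] finite_graph_ball[OF locfin \<Lambda>] by (rule finite_subset)
    moreover have "?\<Psi> \<subseteq> verts G"
      using G \<Lambda>G by (intro graph_ball_subset_verts) (auto simp: subgraph_def)
    ultimately have small: "small_gap G lam \<Lambda> ?\<Psi> \<epsilon>"
      using r graph_ball_disjoint_boundary[of G \<Lambda> r] subset_graph_ball[of \<Lambda> G "Suc r"]
      unfolding insensitive_beyond_def by blast
    \<comment> \<open>Infinitely many \<open>H n\<close> agree with the limit on \<open>B r\<close>,
      so one has \<open>n \<ge> r\<close>. The small gap of the limit carries over to that
      \<open>H n\<close>, in a volume inside its ball of radius \<open>Suc n\<close>; this certifies
      radius \<open>n\<close>, where \<open>H n\<close> was chosen to fail.\<close>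
    from agree[of r] obtain n where n: "n \<ge> r" "verts (H n) \<inter> B r = verts G \<inter> B r"
      "\<forall>e\<subseteq>B r. e \<in> edges (H n) \<longleftrightarrow> e \<in> edges G" by (elim exE conjE)
    have adj: "adj G u v \<longleftrightarrow> adj (H n) u v" if "u \<in> B r" "v \<in> B r" for u v
      using n(3)[rule_format, of "{u, v}"] that by (simp add: adj_def)
    have inB: "graph_ball G' \<Lambda> k \<subseteq> B r" if "subgraph G' T" "k \<le> r + 2" for G' k
      unfolding B_def using ball_T[OF that(1)] graph_ball_mono[OF that(2)] by (rule order_trans)
    have ball: "graph_ball G \<Lambda> k = graph_ball (H n) \<Lambda> k" if "k \<le> r + 2" for k
      using inB[OF G that] inB[OF H(1) that] adj by (rule graph_ball_cong)
    have bd: "boundary G ?\<Psi> = boundary (H n) ?\<Psi>"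
    proof -
      have "adj G u v \<longleftrightarrow> adj (H n) u v" if "u \<in> ?\<Psi>" for u v
      proof -
        have u: "u \<in> B r" using that inB[OF G, of "Suc r"] by auto
        have nbr: "v \<in> B r" if "subgraph G' T" "u \<in> graph_ball G' \<Lambda> (Suc r)" "adj G' u v" for G'
        proof -
          have "v \<in> graph_ball G' \<Lambda> (Suc (Suc r))"
            using that(2,3) unfolding graph_ball.simps(2)[of G' \<Lambda> "Suc r"] by blast
          then show ?thesis using inB[OF that(1), of "Suc (Suc r)"] by (auto simp del: graph_ball.simps)
        qed
        have "v \<in> B r" if "adj G u v"
          using G \<open>u \<in> ?\<Psi>\<close> that by (rule nbr)
        moreover have "v \<in> B r" if "adj (H n) u v"
          using H(1)[of n] _ that by (rule nbr) (use \<open>u \<in> ?\<Psi>\<close> ball[of "Suc r"] in \<open>simp del: graph_ball.simps\<close>)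
        ultimately show ?thesis using adj[OF u] by blast
      qed
      then show ?thesis unfolding boundary_def by blast
    qed
    have "?\<Psi> \<subseteq> B r" using G by (rule inB) simp
    then have "small_gap (H n) lam \<Lambda> ?\<Psi> \<epsilon>"
      using small small_gap_cong[OF adj _ bd, of lam \<Lambda> \<epsilon>] n(2) by blast
    moreover have "?\<Psi> \<subseteq> graph_ball (H n) \<Lambda> (Suc n)"
      using ball[of "Suc r"] graph_ball_mono[of "Suc r" "Suc n" "H n" \<Lambda>] n(1) by (simp del: graph_ball.simps)
    ultimately have "insensitive_beyond (H n) lam \<Lambda> \<epsilon> n"
      using subset_graph_ball[of \<Lambda> G "Suc r"] lam by (intro insensitive_beyondI)
    then show False using H(3) by simp
  qed
qed


section \<open>Mixing passes to subtrees\<close>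

text \<open>A shift of all labels rather than of the tree alone, defined for every \<open>i\<close>.
  Each shift preserves the product measure, and for distinct \<open>i\<close> the shifts read
  disjoint coordinates, none of them the root.\<close>

definition child :: "(nat list \<Rightarrow> nat) \<Rightarrow> nat \<Rightarrow> nat list \<Rightarrow> nat" where
  "child c i = (\<lambda>v. c (i # v))"

lemma Nil_in_tree_verts: "[] \<in> tree_verts c"
  by (simp add: tree_verts_def)

lemma Cons_in_tree_verts: "i # v \<in> tree_verts c \<longleftrightarrow> i < c [] \<and> v \<in> tree_verts (child c i)"
  by (auto simp: tree_verts_def child_def less_Suc_eq_0_disj)

lemma snoc_in_tree_verts: "v @ [i] \<in> tree_verts c \<longleftrightarrow> v \<in> tree_verts c \<and> i < c v"
  by (induction v arbitrary: c)
    (auto simp: Cons_in_tree_verts Nil_in_tree_verts child_def)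

lemma verts_tree_of: "verts (tree_of c) = tree_verts c"
  by (simp add: tree_of_def)

lemma adj_tree_of:
  "adj (tree_of c) u v \<longleftrightarrow>
    (\<exists>i. v = u @ [i] \<and> v \<in> tree_verts c) \<or> (\<exists>i. u = v @ [i] \<and> u \<in> tree_verts c)"
  by (auto simp: adj_def tree_of_def doubleton_eq_iff)

lemma adj_tree_of_Cons:
  "i < c [] \<Longrightarrow> adj (tree_of c) (i # u) (i # v) \<longleftrightarrow> adj (tree_of (child c i)) u v"
  by (auto simp: adj_tree_of Cons_in_tree_verts)

lemma simple_graph_tree_of: "simple_graph (tree_of c)"
  by (auto simp: simple_graph_def tree_of_def snoc_in_tree_verts card_2_iff)

lemma locally_finite_tree_of: "finite {v. adj (tree_of c) u v}"
proof (rule finite_subset)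
  show "{v. adj (tree_of c) u v} \<subseteq> insert (butlast u) ((\<lambda>i. u @ [i]) ` {..<c u})"
    by (auto simp: adj_tree_of snoc_in_tree_verts)
qed simp

text \<open>Every edge joins consecutive depths. This keeps a ball clear of the level at which a
  tree is cut off.\<close>

lemma graph_ball_tree_of_length:
  assumes "v \<in> graph_ball (tree_of c) \<Lambda> r" "\<And>u. u \<in> \<Lambda> \<Longrightarrow> length u \<le> L"
  shows "length v \<le> L + r"
  using assms(1)
proof (induction r arbitrary: v)
  case (Suc r)
  then consider "v \<in> graph_ball (tree_of c) \<Lambda> r"
    | u where "u \<in> graph_ball (tree_of c) \<Lambda> r" "adj (tree_of c) u v" by auto
  then show ?case
  proof cases
    case 2
    then show ?thesis using Suc.IH[of u] by (auto simp: adj_tree_of)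
  qed (use Suc.IH[of v] in simp)
qed (simp add: assms)

lemma graph_ball_mono_set: "\<Lambda> \<subseteq> \<Lambda>' \<Longrightarrow> graph_ball G \<Lambda> r \<subseteq> graph_ball G \<Lambda>' r"
  by (induction r) auto

lemma graph_ball_add: "graph_ball G (graph_ball G \<Lambda> r) s = graph_ball G \<Lambda> (r + s)"
  by (induction s) auto

lemma tree_verts_in_graph_ball_root: "v \<in> tree_verts c \<Longrightarrow> v \<in> graph_ball (tree_of c) {[]} (length v)"
proof (induction v rule: rev_induct)
  case (snoc i v)
  moreover have "adj (tree_of c) v (v @ [i])" using snoc.prems by (auto simp: adj_tree_of)
  ultimately show ?case by (auto simp: snoc_in_tree_verts)
qed simp

lemma root_in_graph_ball: "u \<in> tree_verts c \<Longrightarrow> u \<in> \<Lambda> \<Longrightarrow> [] \<in> graph_ball (tree_of c) \<Lambda> (length u)"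
proof (induction u arbitrary: \<Lambda> rule: rev_induct)
  case (snoc i u)
  have "adj (tree_of c) (u @ [i]) u" using snoc.prems by (auto simp: adj_tree_of)
  then have "u \<in> graph_ball (tree_of c) \<Lambda> 1" using snoc.prems by auto
  then have "[] \<in> graph_ball (tree_of c) (graph_ball (tree_of c) \<Lambda> 1) (length u)"
    using snoc by (intro snoc.IH) (auto simp: snoc_in_tree_verts)
  then show ?case by (simp only: graph_ball_add) simp
qed simp

text \<open>Cutting at a depth, unlike taking balls around \<open>\<Lambda>\<close>, is compatible
  with passing to a child: level \<open>n\<close> of the child's subtree is part of level
  \<open>Suc n\<close> of the tree, and boundary vertices correspond.\<close>

definition tree_trunc :: "(nat list \<Rightarrow> nat) \<Rightarrow> nat \<Rightarrow> nat list set" where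
  "tree_trunc c n = {v \<in> tree_verts c. length v \<le> n}"

lemma tree_trunc_subset_ball: "tree_trunc c n \<subseteq> graph_ball (tree_of c) {[]} n"
proof
  fix v assume "v \<in> tree_trunc c n"
  then have "v \<in> graph_ball (tree_of c) {[]} (length v)" "length v \<le> n"
    by (auto simp: tree_trunc_def tree_verts_in_graph_ball_root)
  then show "v \<in> graph_ball (tree_of c) {[]} n" by (metis graph_ball_mono subsetD)
qed

lemma finite_tree_trunc: "finite (tree_trunc c n)"
  by (rule finite_subset[OF tree_trunc_subset_ball]) (simp add: finite_graph_ball locally_finite_tree_of)

lemma boundary_tree_trunc:
  "boundary (tree_of c) (tree_trunc c n) = {v \<in> tree_verts c. length v = n \<and> c v > 0}"
proof (intro equalityI subsetI)
  fix v assume "v \<in> boundary (tree_of c) (tree_trunc c n)"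
  then obtain w where "v \<in> tree_trunc c n" "adj (tree_of c) v w" "w \<notin> tree_trunc c n"
    by (auto simp: boundary_def)
  then show "v \<in> {v \<in> tree_verts c. length v = n \<and> c v > 0}"
    by (auto simp: tree_trunc_def adj_tree_of snoc_in_tree_verts)
next
  fix v assume v: "v \<in> {v \<in> tree_verts c. length v = n \<and> c v > 0}"
  then have "adj (tree_of c) v (v @ [0])" by (auto simp: adj_tree_of snoc_in_tree_verts)
  then show "v \<in> boundary (tree_of c) (tree_trunc c n)"
    using v by (auto simp: boundary_def tree_trunc_def)
qed

lemma subgraph_map_graph_Cons:
  assumes "i < c []" "subgraph H (tree_of (child c i))"
  shows "subgraph (map_graph (Cons i) H) (tree_of c)"
proof -
  have "simple_graph (map_graph (Cons i) H)"
    using assms(2) by (intro simple_graph_map_graph) (auto simp: subgraph_def)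
  moreover have "verts (map_graph (Cons i) H) \<subseteq> verts (tree_of c)"
    using assms by (auto simp: map_graph_def subgraph_def verts_tree_of Cons_in_tree_verts)
  moreover have "edges (map_graph (Cons i) H) \<subseteq> edges (tree_of c)"
  proof
    fix e assume "e \<in> edges (map_graph (Cons i) H)"
    then obtain e' where e': "e = Cons i ` e'" "e' \<in> edges (tree_of (child c i))"
      using assms(2) by (auto simp: map_graph_def subgraph_def)
    then obtain v j where "e' = {v, v @ [j]}" "v @ [j] \<in> tree_verts (child c i)"
      by (auto simp: tree_of_def)
    then have "e = {i # v, (i # v) @ [j]}" "(i # v) @ [j] \<in> tree_verts c"
      using assms(1) e' by (auto simp: Cons_in_tree_verts)
    then show "e \<in> edges (tree_of c)" unfolding tree_of_def snd_conv by blast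
  qed
  ultimately show ?thesis by (simp add: subgraph_def)
qed

lemma strong_spatial_mixing_child:
  assumes "lam > 0" "i < c []" "strong_spatial_mixing (tree_of c) lam"
  shows "strong_spatial_mixing (tree_of (child c i)) lam"
  unfolding strong_spatial_mixing_def
proof (intro allI impI)
  fix H assume "subgraph H (tree_of (child c i))"
  with assms(2) have "subgraph (map_graph (Cons i) H) (tree_of c)" by (rule subgraph_map_graph_Cons)
  with assms(3) have "weak_spatial_mixing (map_graph (Cons i) H) lam"
    unfolding strong_spatial_mixing_def by blast
  then show "weak_spatial_mixing H lam"
    by (rule weak_spatial_mixing_map_graph[OF assms(1), rotated]) simp
qed

section \<open>Inheritance of weak mixing through a vacant root\<close>

lemma hc_marginal_le_1:
  assumes "lam > 0" "finite \<Psi>" "boundary_condition G \<Psi> \<sigma>"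
  shows "hc_marginal G lam \<Psi> \<sigma> \<Lambda> A \<le> 1"
proof -
  have "hc_weight G lam \<Psi> \<sigma> \<Lambda> A \<le> hc_weight G lam \<Psi> \<sigma> {} {}"
    unfolding hc_weight_def using finite_hc_configs[OF assms(2), of G \<sigma>] assms(1)
    by (intro sum_mono2) auto
  then show ?thesis using hc_weight_total_pos[OF assms] by (simp add: hc_marginal_def)
qed

text \<open>Emptying an occupied interior vertex loses only a factor \<open>lam\<close>.\<close>

lemma hc_marginal_vacant_ge:
  assumes lam: "lam > 0" and fin: "finite \<Psi>" and bc: "boundary_condition G \<Psi> \<sigma>"
    and v: "v \<notin> boundary G \<Psi>"
  shows "hc_marginal G lam \<Psi> \<sigma> {v} {} \<ge> 1 / (1 + lam)"
proof -
  define C0 where "C0 = {S \<in> hc_configs G \<Psi> \<sigma>. v \<notin> S}"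
  define C1 where "C1 = {S \<in> hc_configs G \<Psi> \<sigma>. v \<in> S}"
  have finC: "finite C0" "finite C1"
    using finite_hc_configs[OF fin, of G \<sigma>] by (auto simp: C0_def C1_def)
  have w0: "hc_weight G lam \<Psi> \<sigma> {v} {} = (\<Sum>S\<in>C0. lam ^ card S)"
    by (simp add: hc_weight_def C0_def)
  have "hc_weight G lam \<Psi> \<sigma> {} {} = (\<Sum>S\<in>C0 \<union> C1. lam ^ card S)"
    unfolding hc_weight_def by (rule sum.cong) (auto simp: C0_def C1_def)
  also have "\<dots> = (\<Sum>S\<in>C0. lam ^ card S) + (\<Sum>S\<in>C1. lam ^ card S)"
    using finC by (rule sum.union_disjoint) (auto simp: C0_def C1_def)
  also have "(\<Sum>S\<in>C1. lam ^ card S) = (\<Sum>S\<in>C1. lam * lam ^ card (S - {v}))"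
  proof (rule sum.cong[OF refl])
    fix S assume "S \<in> C1"
    then have "v \<in> S" "finite S" using fin by (auto simp: C1_def hc_configs_def intro: finite_subset)
    then have "card S = Suc (card (S - {v}))" by (metis card.remove)
    then show "lam ^ card S = lam * lam ^ card (S - {v})" by simp
  qed
  \<comment> \<open>Deleting \<open>v\<close> is injective on sets containing \<open>v\<close>, and
    since \<open>v\<close> is no boundary vertex it respects \<open>\<sigma>\<close>; so it maps
    \<open>C1\<close> into \<open>C0\<close>.\<close>
  also have "\<dots> = lam * (\<Sum>S\<in>(\<lambda>S. S - {v}) ` C1. lam ^ card S)"
    by (subst sum.reindex) (auto simp: inj_on_def C1_def sum_distrib_left)
  also have "\<dots> \<le> lam * (\<Sum>S\<in>C0. lam ^ card S)"
  proof -
    have "(\<lambda>S. S - {v}) ` C1 \<subseteq> C0"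
      using v by (auto simp: C0_def C1_def hc_configs_def intro: indep_set_mono)
    then show ?thesis using lam finC by (intro mult_left_mono sum_mono2) auto
  qed
  finally have "hc_weight G lam \<Psi> \<sigma> {} {} \<le> (1 + lam) * hc_weight G lam \<Psi> \<sigma> {v} {}"
    by (simp add: w0 algebra_simps)
  then show ?thesis
    using hc_weight_total_pos[OF lam fin bc] lam by (simp add: hc_marginal_def field_simps)
qed

text \<open>
  The hard-core model on the subtree of a child of the root is that on the whole tree conditioned
  on the root being unoccupied.
\<close>

lemma hc_weight_child:
  assumes lam: "lam > 0" and i: "i < c []"
  obtains W where "W > 0"
    "\<And>\<sigma> \<Lambda> A. \<sigma> \<subseteq> tree_trunc (child c i) n \<Longrightarrow> \<Lambda> \<subseteq> tree_trunc (child c i) n \<Longrightarrow> A \<subseteq> \<Lambda> \<Longrightarrow>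
      hc_weight (tree_of c) lam (tree_trunc c (Suc n)) (Cons i ` \<sigma>) (Cons i ` \<Lambda> \<union> {[]}) (Cons i ` A) =
      W * hc_weight (tree_of (child c i)) lam (tree_trunc (child c i) n) \<sigma> \<Lambda> A"
proof -
  let ?\<Psi> = "tree_trunc (child c i) n" and ?f = "Cons i"
  \<comment> \<open>The truncated subtrees of the other children; the root alone separates them from
    the copy and plays the part of \<open>K\<close>.\<close>
  define U where "U = {v \<in> tree_trunc c (Suc n). v \<noteq> [] \<and> hd v \<noteq> i}"
  \<comment> \<open>The partition function of the other subtrees with their boundary vertices
    vacant. It depends on none of \<open>\<sigma>\<close>, \<open>\<Lambda>\<close>,
    \<open>A\<close> and hence cancels from quotients of weights.\<close>
  define W where "W = (\<Sum>R | R \<subseteq> U \<and> indep_set (tree_of c) R \<and>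
      R \<inter> boundary (tree_of c) (?f ` ?\<Psi> \<union> {[]} \<union> U) = {}. lam ^ card R)"
  have finU: "finite U" by (simp add: U_def finite_tree_trunc)
  have \<Psi>': "?f ` ?\<Psi> \<union> {[]} \<union> U = tree_trunc c (Suc n)"
  proof (rule set_eqI)
    fix v show "v \<in> ?f ` ?\<Psi> \<union> {[]} \<union> U \<longleftrightarrow> v \<in> tree_trunc c (Suc n)"
      using i by (cases v) (auto simp: U_def tree_trunc_def Nil_in_tree_verts Cons_in_tree_verts)
  qed
  have "W > 0"
  proof -
    have "finite {R. R \<subseteq> U \<and> indep_set (tree_of c) R \<and>
      R \<inter> boundary (tree_of c) (?f ` ?\<Psi> \<union> {[]} \<union> U) = {}}"
      by (rule finite_subset[of _ "Pow U"]) (use finU in auto)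
    moreover have "{} \<in> {R. R \<subseteq> U \<and> indep_set (tree_of c) R \<and>
      R \<inter> boundary (tree_of c) (?f ` ?\<Psi> \<union> {[]} \<union> U) = {}}" by (simp add: indep_set_def)
    ultimately show ?thesis unfolding W_def using lam by (intro sum_pos) auto
  qed
  moreover have "hc_weight (tree_of c) lam (tree_trunc c (Suc n)) (?f ` \<sigma>) (?f ` \<Lambda> \<union> {[]}) (?f ` A) =
      W * hc_weight (tree_of (child c i)) lam ?\<Psi> \<sigma> \<Lambda> A"
    if "\<sigma> \<subseteq> ?\<Psi>" "\<Lambda> \<subseteq> ?\<Psi>" "A \<subseteq> \<Lambda>" for \<sigma> \<Lambda> A
    unfolding \<Psi>'[symmetric] W_def
  proof (rule hc_weight_embedding)
    show "adj (tree_of c) (i # u) (i # v) \<longleftrightarrow> adj (tree_of (child c i)) u v" for u v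
      using i by (rule adj_tree_of_Cons)
    show "i # u \<in> verts (tree_of c) \<longleftrightarrow> u \<in> verts (tree_of (child c i))" for u
      using i by (simp add: verts_tree_of Cons_in_tree_verts)
    show "\<not> adj (tree_of c) (i # u) v" if "v \<in> U" for u v
      using that by (cases v) (auto simp: adj_tree_of U_def)
    show "?f ` ?\<Psi> \<inter> boundary (tree_of c) (?f ` ?\<Psi> \<union> {[]} \<union> U) = ?f ` boundary (tree_of (child c i)) ?\<Psi>"
      unfolding \<Psi>' boundary_tree_trunc using i
      by (auto simp: Cons_in_tree_verts tree_trunc_def child_def[of c i])
    show "{[]} \<inter> boundary (tree_of c) (?f ` ?\<Psi> \<union> {[]} \<union> U) = {}"
      unfolding \<Psi>' boundary_tree_trunc by simp
  qed (use that finU finite_tree_trunc in \<open>auto simp: U_def\<close>)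
  ultimately show ?thesis by (rule that)
qed

text \<open>The child's marginal is \<open>x = a / b\<close>, with \<open>a\<close> the probability
  of the trace together with a vacant root and \<open>b\<close> that of a vacant root. Both change
  by less than \<open>\<delta>\<close> and \<open>b \<ge> 1 / (1 + lam)\<close>, so \<open>x\<close>
  changes by less than \<open>2 * \<delta> * (1 + lam) = \<epsilon>\<close>.\<close>

lemma small_gap_child:
  assumes lam: "lam > 0" and i: "i < c []" and \<Lambda>: "\<Lambda> \<subseteq> tree_trunc (child c i) n" and \<epsilon>: "\<epsilon> > 0"
  defines "\<delta> \<equiv> \<epsilon> / (2 * (1 + lam))"
  assumes gap1: "small_gap (tree_of c) lam (Cons i ` \<Lambda> \<union> {[]}) (tree_trunc c (Suc n)) \<delta>"
    and gap2: "small_gap (tree_of c) lam {[]} (tree_trunc c (Suc n)) \<delta>"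
  shows "small_gap (tree_of (child c i)) lam \<Lambda> (tree_trunc (child c i) n) \<epsilon>"
  unfolding small_gap_def
proof (intro allI impI)
  let ?G' = "tree_of (child c i)" and ?\<Psi>' = "tree_trunc (child c i) n" and ?f = "Cons i"
  let ?G = "tree_of c" and ?\<Psi> = "tree_trunc c (Suc n)"
  fix \<sigma> \<tau> A assume bc: "boundary_condition ?G' ?\<Psi>' \<sigma>" "boundary_condition ?G' ?\<Psi>' \<tau>"
  obtain W where W: "W > 0"
    "\<And>\<sigma> \<Lambda> A. \<sigma> \<subseteq> ?\<Psi>' \<Longrightarrow> \<Lambda> \<subseteq> ?\<Psi>' \<Longrightarrow> A \<subseteq> \<Lambda> \<Longrightarrow>
      hc_weight ?G lam ?\<Psi> (?f ` \<sigma>) (?f ` \<Lambda> \<union> {[]}) (?f ` A) = W * hc_weight ?G' lam ?\<Psi>' \<sigma> \<Lambda> A"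
    using hc_weight_child[of lam i c n, OF lam i] by metis
  define x where "x \<sigma> = hc_marginal ?G' lam ?\<Psi>' \<sigma> \<Lambda> A" for \<sigma>
  define a where "a \<sigma> = hc_marginal ?G lam ?\<Psi> (?f ` \<sigma>) (?f ` \<Lambda> \<union> {[]}) (?f ` A)" for \<sigma>
  define b where "b \<sigma> = hc_marginal ?G lam ?\<Psi> (?f ` \<sigma>) {[]} {}" for \<sigma>
  \<comment> \<open>The lifted boundary condition leaves all boundary vertices in the other
    children's subtrees unoccupied.\<close>
  have bc': "boundary_condition ?G ?\<Psi> (?f ` \<sigma>)" if "boundary_condition ?G' ?\<Psi>' \<sigma>" for \<sigma>
    using that i
    by (fastforce simp: boundary_condition_def boundary_tree_trunc indep_set_def verts_tree_of
        Cons_in_tree_verts adj_tree_of_Cons child_def[of c i])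
  show "\<bar>hc_marginal ?G' lam ?\<Psi>' \<sigma> \<Lambda> A - hc_marginal ?G' lam ?\<Psi>' \<tau> \<Lambda> A\<bar> < \<epsilon>"
  proof (cases "A \<subseteq> \<Lambda>")
    case False
    then show ?thesis using \<epsilon> by (simp add: hc_marginal_not_subset)
  next
    case True
    have ab: "a \<sigma> = x \<sigma> * b \<sigma>" if bc: "boundary_condition ?G' ?\<Psi>' \<sigma>" for \<sigma>
    proof -
      have sub: "\<sigma> \<subseteq> ?\<Psi>'" using bc by (auto simp: boundary_condition_def boundary_def)
      have "hc_weight ?G' lam ?\<Psi>' \<sigma> {} {} > 0"
        using lam finite_tree_trunc bc by (rule hc_weight_total_pos)
      then show ?thesis
        using W(2)[OF sub \<Lambda> True] W(2)[OF sub, of "{}" "{}"]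
        by (simp add: a_def b_def x_def hc_marginal_def)
    qed
    have x: "0 \<le> x \<sigma>" "x \<sigma> \<le> 1"
      unfolding x_def hc_marginal_def[of ?G'] using lam
      by (simp_all add: hc_weight_nonneg hc_marginal_le_1[OF lam finite_tree_trunc bc(1), of \<Lambda> A, unfolded hc_marginal_def])
    have b: "b \<tau> \<ge> 1 / (1 + lam)"
      unfolding b_def using bc'[OF bc(2)] lam
      by (intro hc_marginal_vacant_ge finite_tree_trunc) (auto simp: boundary_tree_trunc)
    have diff: "\<bar>a \<sigma> - a \<tau>\<bar> < \<delta>" "\<bar>b \<sigma> - b \<tau>\<bar> < \<delta>"
      using gap1 gap2 bc'[OF bc(1)] bc'[OF bc(2)] by (simp_all add: small_gap_def a_def b_def)
    have "\<bar>x \<sigma> * (b \<sigma> - b \<tau>)\<bar> \<le> \<bar>b \<sigma> - b \<tau>\<bar>"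
      using x by (simp add: abs_mult mult_left_le_one_le)
    \<comment> \<open>This form of the difference of two quotients involves only
      \<open>b \<tau>\<close> as a factor to be bounded below, and only
      \<open>x \<sigma> \<le> 1\<close> from above.\<close>
    moreover have "(x \<sigma> - x \<tau>) * b \<tau> = (a \<sigma> - a \<tau>) - x \<sigma> * (b \<sigma> - b \<tau>)"
      using ab[OF bc(1)] ab[OF bc(2)] by (simp add: algebra_simps)
    ultimately have "\<bar>(x \<sigma> - x \<tau>) * b \<tau>\<bar> < 2 * \<delta>" using diff by linarith
    moreover have "\<bar>x \<sigma> - x \<tau>\<bar> * (1 / (1 + lam)) \<le> \<bar>(x \<sigma> - x \<tau>) * b \<tau>\<bar>"
    proof -
      have "b \<tau> > 0" using b lam by (smt (verit) divide_pos_pos)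
      then show ?thesis using mult_left_mono[OF b, of "\<bar>x \<sigma> - x \<tau>\<bar>"] by (simp add: abs_mult)
    qed
    moreover have "2 * \<delta> = \<epsilon> / (1 + lam)" using lam by (simp add: \<delta>_def field_simps)
    ultimately have "\<bar>x \<sigma> - x \<tau>\<bar> / (1 + lam) < \<epsilon> / (1 + lam)" by simp
    then show ?thesis using lam by (simp add: x_def divide_less_cancel)
  qed
qed

lemma weak_spatial_mixing_child:
  assumes lam: "lam > 0" and i: "i < c []" and wsm: "weak_spatial_mixing (tree_of c) lam"
  shows "weak_spatial_mixing (tree_of (child c i)) lam"
  unfolding weak_spatial_mixing_iff[OF lam]
proof (intro allI impI)
  let ?G' = "tree_of (child c i)"
  fix \<Lambda> and \<epsilon> :: real
  assume \<Lambda>: "finite \<Lambda>" "\<Lambda> \<subseteq> verts ?G'" and \<epsilon>: "\<epsilon> > 0"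
  show "\<exists>r. insensitive_beyond ?G' lam \<Lambda> \<epsilon> r"
  proof (cases "\<Lambda> = {}")
    case True
    \<comment> \<open>For empty \<open>\<Lambda>\<close> all balls are empty, so no truncated tree
      fits into one; the empty volume serves instead.\<close>
    have "small_gap ?G' lam {} {} \<epsilon>"
      using \<epsilon> by (intro small_gap_if_boundary_empty) (auto simp: boundary_def)
    then have "insensitive_beyond ?G' lam \<Lambda> \<epsilon> 0"
      unfolding True using lam by (intro insensitive_beyondI[of _ _ "{}"]) auto
    then show ?thesis ..
  next
    case False
    then obtain u where u: "u \<in> \<Lambda>" by blast
    define \<delta> where "\<delta> = \<epsilon> / (2 * (1 + lam))"
    have \<delta>: "\<delta> > 0" using \<epsilon> lam by (simp add: \<delta>_def)
    have root: "{[]} \<subseteq> verts (tree_of c)" by (simp add: verts_tree_of Nil_in_tree_verts)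
    have "Cons i ` \<Lambda> \<union> {[]} \<subseteq> verts (tree_of c)"
      using \<Lambda>(2) i root by (auto simp: verts_tree_of Cons_in_tree_verts)
    then obtain r1 where r1: "insensitive_beyond (tree_of c) lam (Cons i ` \<Lambda> \<union> {[]}) \<delta> r1"
      using wsm \<delta> \<Lambda>(1) unfolding weak_spatial_mixing_iff[OF lam]
      by (metis finite.emptyI finite.insertI finite_UnI finite_imageI)
    obtain r2 where r2: "insensitive_beyond (tree_of c) lam {[]} \<delta> r2"
      using wsm \<delta> root unfolding weak_spatial_mixing_iff[OF lam]
      by (metis finite.emptyI finite.insertI)
    define L where "L = Max (length ` \<Lambda>)"
    have L: "length v \<le> L" if "v \<in> \<Lambda>" for v using \<Lambda>(1) that by (simp add: L_def)
    \<comment> \<open>After prepending \<open>i\<close>, the sets in question have depth at most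
      \<open>L + 1\<close>, and their balls of radius at most \<open>r1 + r2\<close> have depth at
      most \<open>L + 1 + r1 + r2\<close>. This is one less than \<open>Suc n\<close>, the depth of
      the boundary of the truncated tree.\<close>
    define n where "n = L + r1 + r2 + 1"
    have gap: "small_gap (tree_of c) lam \<Lambda>' (tree_trunc c (Suc n)) \<delta>"
      if "insensitive_beyond (tree_of c) lam \<Lambda>' \<delta> r" "r \<le> r1 + r2" "\<Lambda>' \<subseteq> Cons i ` \<Lambda> \<union> {[]}" for \<Lambda>' r
    proof -
      have len: "length v \<le> Suc L" if "v \<in> \<Lambda>'" for v
        using that \<open>\<Lambda>' \<subseteq> _\<close> L by auto
      have "\<Lambda>' \<subseteq> tree_trunc c (Suc n)"
        using len \<open>\<Lambda>' \<subseteq> _\<close> \<open>Cons i ` \<Lambda> \<union> {[]} \<subseteq> _\<close> by (fastforce simp: tree_trunc_def n_def verts_tree_of)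
      moreover have "graph_ball (tree_of c) \<Lambda>' r \<inter> boundary (tree_of c) (tree_trunc c (Suc n)) = {}"
        using graph_ball_tree_of_length[of _ c \<Lambda>' r "Suc L"] len that(2)
        by (fastforce simp: boundary_tree_trunc n_def)
      moreover have "tree_trunc c (Suc n) \<subseteq> verts (tree_of c)"
        by (auto simp: tree_trunc_def verts_tree_of)
      ultimately show ?thesis
        using that(1) finite_tree_trunc unfolding insensitive_beyond_def by blast
    qed
    have \<Lambda>': "\<Lambda> \<subseteq> tree_trunc (child c i) n"
      using \<Lambda>(2) L by (fastforce simp: tree_trunc_def n_def verts_tree_of)
    have "small_gap ?G' lam \<Lambda> (tree_trunc (child c i) n) \<epsilon>"
      using lam i \<Lambda>' \<epsilon> gap[OF r1] gap[OF r2]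
      by (intro small_gap_child) (auto simp: \<delta>_def)
    \<comment> \<open>From \<open>u\<close> one climbs \<open>length u\<close> steps to the root and
      then descends at most \<open>n\<close> steps.\<close>
    moreover have "tree_trunc (child c i) n \<subseteq> graph_ball ?G' \<Lambda> (Suc (length u + n))"
    proof -
      have "{[]} \<subseteq> graph_ball ?G' \<Lambda> (length u)"
        using root_in_graph_ball[of u "child c i" \<Lambda>] u \<Lambda>(2) by (auto simp: verts_tree_of)
      then have "graph_ball ?G' {[]} n \<subseteq> graph_ball ?G' \<Lambda> (length u + n)"
        unfolding graph_ball_add[symmetric] by (rule graph_ball_mono_set)
      then show ?thesis
        using tree_trunc_subset_ball[of "child c i" n] by auto
    qed
    ultimately have "insensitive_beyond ?G' lam \<Lambda> \<epsilon> (length u + n)"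
      using lam \<Lambda>' by (intro insensitive_beyondI)
    then show ?thesis ..
  qed
qed


section \<open>Measurability\<close>

lemma space_poisson_offspring: "space (poisson_offspring d) = UNIV"
  by (simp add: poisson_offspring_def space_PiM)

lemma measurable_offspring [measurable]:
  "(\<lambda>c. c v) \<in> measurable (poisson_offspring d) (count_space UNIV)"
proof -
  have "(\<lambda>c. c v) \<in> measurable (poisson_offspring d) (measure_pmf (poisson_pmf d))"
    unfolding poisson_offspring_def by (rule measurable_component_singleton) simp
  then show ?thesis by (simp cong: measurable_cong_sets)
qed

lemma pred_offspring: "Measurable.pred (poisson_offspring d) (\<lambda>c. Q (c v))"
  by (rule measurable_compose[OF measurable_offspring]) simp

lemma pred_tree_verts [measurable]: "Measurable.pred (poisson_offspring d) (\<lambda>c. v \<in> tree_verts c)"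
  unfolding tree_verts_def mem_Collect_eq
  by (intro pred_intros_countable pred_intros_imp' pred_offspring)

lemma pred_adj_tree_of [measurable]: "Measurable.pred (poisson_offspring d) (\<lambda>c. adj (tree_of c) u v)"
  unfolding adj_tree_of by measurable

lemma pred_graph_ball_tree_of [measurable]:
  "Measurable.pred (poisson_offspring d) (\<lambda>c. v \<in> graph_ball (tree_of c) \<Lambda> r)"
proof (induction r arbitrary: v)
  case (Suc r)
  note [measurable] = Suc.IH
  have "Measurable.pred (poisson_offspring d) (\<lambda>c. v \<in> graph_ball (tree_of c) \<Lambda> r \<or>
      (\<exists>u. u \<in> graph_ball (tree_of c) \<Lambda> r \<and> adj (tree_of c) u v))"
    by measurable
  then show ?case by (simp add: Bex_def)
qed simp

lemma pred_boundary_tree_of [measurable]: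
  "Measurable.pred (poisson_offspring d) (\<lambda>c. v \<in> boundary (tree_of c) \<Psi>)"
  unfolding boundary_def mem_Collect_eq by measurable

lemma pred_indep_set_tree_of [measurable]:
  "Measurable.pred (poisson_offspring d) (\<lambda>c. indep_set (tree_of c) S)"
  unfolding indep_set_def verts_tree_of subset_iff Ball_def by measurable

lemma pred_boundary_condition_tree_of [measurable]:
  "Measurable.pred (poisson_offspring d) (\<lambda>c. boundary_condition (tree_of c) \<Psi> \<sigma>)"
  unfolding boundary_condition_def subset_iff by measurable

lemma pred_hc_configs_tree_of [measurable]:
  "Measurable.pred (poisson_offspring d) (\<lambda>c. S \<in> hc_configs (tree_of c) \<Psi> \<sigma>)"
  unfolding hc_configs_def mem_Collect_eq set_eq_iff Int_iff by measurable

text \<open>The index set becomes independent of the graph, so for a random tree only the summands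
  vary, through measurable conditions.\<close>

lemma hc_weight_eq_sum_Pow:
  assumes "finite \<Psi>"
  shows "hc_weight G lam \<Psi> \<sigma> \<Lambda> A =
    (\<Sum>S\<in>Pow \<Psi>. if S \<in> hc_configs G \<Psi> \<sigma> then if S \<inter> \<Lambda> = A then lam ^ card S else 0 else 0)"
  unfolding hc_weight_eq_sum_if[OF assms]
  by (rule sum.mono_neutral_cong_left) (use assms in \<open>auto simp: hc_configs_def\<close>)

lemma measurable_hc_marginal_tree_of:
  assumes "finite \<Psi>"
  shows "(\<lambda>c. hc_marginal (tree_of c) lam \<Psi> \<sigma> \<Lambda> A) \<in> borel_measurable (poisson_offspring d)"
  unfolding hc_marginal_def hc_weight_eq_sum_Pow[OF assms] by measurable

text \<open>Turns the quantifiers over arbitrary sets into finite ones. Nothing is lost: boundary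
  conditions are subsets of \<open>\<Psi>\<close>, and both marginals vanish if \<open>A\<close> is
  not a subset of \<open>\<Lambda>\<close>.\<close>

lemma small_gap_iff_Pow:
  assumes "\<epsilon> > 0"
  shows "small_gap G lam \<Lambda> \<Psi> \<epsilon> \<longleftrightarrow>
    (\<forall>\<sigma>\<in>Pow \<Psi>. \<forall>\<tau>\<in>Pow \<Psi>. \<forall>A\<in>Pow \<Lambda>. boundary_condition G \<Psi> \<sigma> \<longrightarrow> boundary_condition G \<Psi> \<tau> \<longrightarrow>
     \<bar>hc_marginal G lam \<Psi> \<sigma> \<Lambda> A - hc_marginal G lam \<Psi> \<tau> \<Lambda> A\<bar> < \<epsilon>)" (is "_ \<longleftrightarrow> ?R")
proof
  assume R: ?R
  show "small_gap G lam \<Lambda> \<Psi> \<epsilon>"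
    unfolding small_gap_def
  proof (intro allI impI)
    fix \<sigma> \<tau> A assume bc: "boundary_condition G \<Psi> \<sigma>" "boundary_condition G \<Psi> \<tau>"
    show "\<bar>hc_marginal G lam \<Psi> \<sigma> \<Lambda> A - hc_marginal G lam \<Psi> \<tau> \<Lambda> A\<bar> < \<epsilon>"
    proof (cases "A \<subseteq> \<Lambda>")
      case True
      have "\<sigma> \<in> Pow \<Psi>" "\<tau> \<in> Pow \<Psi>" using bc by (auto simp: boundary_condition_def boundary_def)
      with R True bc show ?thesis by simp
    qed (simp add: hc_marginal_not_subset assms)
  qed
qed (simp add: small_gap_def)

lemma pred_small_gap_tree_of:
  assumes "finite \<Lambda>" "finite \<Psi>" "\<epsilon> > 0"
  shows "Measurable.pred (poisson_offspring d) (\<lambda>c. small_gap (tree_of c) lam \<Lambda> \<Psi> \<epsilon>)"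
proof -
  note [measurable] = measurable_hc_marginal_tree_of[OF assms(2)]
  show ?thesis
    unfolding small_gap_iff_Pow[OF assms(3)]
    using assms by (intro pred_intros_finite) simp_all
qed

lemma pred_insensitive_beyond_tree_of:
  assumes "finite \<Lambda>" "\<epsilon> > 0"
  shows "Measurable.pred (poisson_offspring d) (\<lambda>c. insensitive_beyond (tree_of c) lam \<Lambda> \<epsilon> r)"
proof -
  \<comment> \<open>Finite volumes are enumerated by lists: lists of vertices form a countable type,
    sets of vertices do not.\<close>
  have "insensitive_beyond (tree_of c) lam \<Lambda> \<epsilon> r \<longleftrightarrow>
      (\<forall>xs. \<Lambda> \<subseteq> set xs \<longrightarrow> (\<forall>v. v \<in> set xs \<longrightarrow> v \<in> tree_verts c) \<longrightarrow>
        (\<forall>v. \<not> (v \<in> graph_ball (tree_of c) \<Lambda> r \<and> v \<in> boundary (tree_of c) (set xs))) \<longrightarrow>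
        small_gap (tree_of c) lam \<Lambda> (set xs) \<epsilon>)" for c
    unfolding insensitive_beyond_def verts_tree_of
    by (intro iffI allI impI) (auto simp: disjoint_iff subset_iff dest!: finite_list)
  moreover note [measurable] = pred_small_gap_tree_of[OF assms(1) finite_set assms(2)]
  ultimately show ?thesis by simp
qed

lemma insensitive_beyond_weaken:
  assumes "insensitive_beyond G lam \<Lambda> \<epsilon> r" "\<epsilon> \<le> \<epsilon>'"
  shows "insensitive_beyond G lam \<Lambda> \<epsilon>' r"
proof -
  have "small_gap G lam \<Lambda> \<Psi> \<epsilon>'" if "small_gap G lam \<Lambda> \<Psi> \<epsilon>" for \<Psi>
    using that assms(2) unfolding small_gap_def by (meson less_le_trans)
  then show ?thesis using assms(1) unfolding insensitive_beyond_def by blast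
qed

lemma pred_weak_spatial_mixing_tree_of:
  assumes "lam > 0"
  shows "Measurable.pred (poisson_offspring d) (\<lambda>c. weak_spatial_mixing (tree_of c) lam)"
proof -
  have eq: "weak_spatial_mixing (tree_of c) lam \<longleftrightarrow>
      (\<forall>xs (k::nat). (\<forall>v. v \<in> set xs \<longrightarrow> v \<in> tree_verts c) \<longrightarrow>
        (\<exists>r. insensitive_beyond (tree_of c) lam (set xs) (1 / real (Suc k)) r))" for c
    unfolding weak_spatial_mixing_iff[OF assms] verts_tree_of
  proof (intro iffI allI impI)
    fix \<Lambda> and \<epsilon> :: real
    assume R: "\<forall>xs (k::nat). (\<forall>v. v \<in> set xs \<longrightarrow> v \<in> tree_verts c) \<longrightarrow>
        (\<exists>r. insensitive_beyond (tree_of c) lam (set xs) (1 / real (Suc k)) r)"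
      and \<Lambda>: "finite \<Lambda>" "\<Lambda> \<subseteq> tree_verts c" and \<epsilon>: "\<epsilon> > 0"
    obtain xs where xs: "set xs = \<Lambda>" using finite_list[OF \<Lambda>(1)] ..
    obtain k where k: "1 / real (Suc k) < \<epsilon>" using nat_approx_posE[OF \<epsilon>] by metis
    obtain r where "insensitive_beyond (tree_of c) lam \<Lambda> (1 / real (Suc k)) r"
      using R[rule_format, of xs k] \<Lambda>(2) xs by blast
    then show "\<exists>r. insensitive_beyond (tree_of c) lam \<Lambda> \<epsilon> r"
      using k by (meson insensitive_beyond_weaken less_imp_le)
  qed auto
  show ?thesis
    unfolding eq
    by (intro pred_intros_countable pred_intros_imp' pred_intros_logic
        pred_insensitive_beyond_tree_of pred_tree_verts) auto
qed

text \<open>Finite subgraphs are coded by a list of vertices and a list of lists for the edges,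
  again to quantify over a countable type.\<close>

lemma pred_subgraph_tree_of [measurable]:
  "Measurable.pred (poisson_offspring d) (\<lambda>c. subgraph (set vs, set ` set es) (tree_of c))"
proof -
  have "subgraph (set vs, set ` set es) (tree_of c) \<longleftrightarrow>
      simple_graph (set vs, set ` set es) \<and> (\<forall>v. v \<in> set vs \<longrightarrow> v \<in> tree_verts c) \<and>
      (\<forall>e. e \<in> set es \<longrightarrow> (\<exists>v i. set e = {v, v @ [i]} \<and> v @ [i] \<in> tree_verts c))" for c
    by (auto simp: subgraph_def tree_of_def subset_iff)
  then show ?thesis by simp
qed

lemma finite_sets_eq_set_image:
  assumes "finite E" "\<And>e. e \<in> E \<Longrightarrow> finite e"
  obtains es where "set ` set es = E"
proof -
  have "E \<subseteq> range set" using assms(2) finite_list by (metis range_eqI subsetI)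
  then obtain C where "finite C" "E = set ` C" using assms(1) by (metis finite_subset_image)
  then show ?thesis using finite_list that by metis
qed

text \<open>In the uniform form over finite subgraphs the insensitivity statement concerns a fixed
  graph and is deterministic. The randomness enters only through which finite graphs are subgraphs
  of the tree.\<close>

lemma pred_strong_spatial_mixing_tree_of:
  assumes "lam > 0"
  shows "Measurable.pred (poisson_offspring d) (\<lambda>c. strong_spatial_mixing (tree_of c) lam)"
proof -
  have eq: "strong_spatial_mixing (tree_of c) lam \<longleftrightarrow>
      (\<forall>xs (k::nat). \<exists>r. \<forall>vs es. subgraph (set vs, set ` set es) (tree_of c) \<longrightarrow> set xs \<subseteq> set vs \<longrightarrow>
        insensitive_beyond (set vs, set ` set es) lam (set xs) (1 / real (Suc k)) r)" for c
    unfolding strong_spatial_mixing_iff[OF assms locally_finite_tree_of]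
  proof (intro iffI allI impI)
    fix xs :: "nat list list" and k :: nat
    assume R: "\<forall>\<Lambda> \<epsilon>. finite \<Lambda> \<longrightarrow> \<epsilon> > 0 \<longrightarrow> (\<exists>r. \<forall>H. subgraph H (tree_of c) \<longrightarrow> finite (verts H) \<longrightarrow>
        \<Lambda> \<subseteq> verts H \<longrightarrow> insensitive_beyond H lam \<Lambda> \<epsilon> r)"
    have "finite (set xs)" "1 / real (Suc k) > 0" by auto
    with R obtain r where r: "\<And>H. subgraph H (tree_of c) \<Longrightarrow> finite (verts H) \<Longrightarrow>
        set xs \<subseteq> verts H \<Longrightarrow> insensitive_beyond H lam (set xs) (1 / real (Suc k)) r" by meson
    show "\<exists>r. \<forall>vs es. subgraph (set vs, set ` set es) (tree_of c) \<longrightarrow> set xs \<subseteq> set vs \<longrightarrow>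
        insensitive_beyond (set vs, set ` set es) lam (set xs) (1 / real (Suc k)) r"
      by (intro exI[of _ r] allI impI r) auto
  next
    fix \<Lambda> :: "nat list set" and \<epsilon> :: real
    assume R: "\<forall>xs (k::nat). \<exists>r. \<forall>vs es. subgraph (set vs, set ` set es) (tree_of c) \<longrightarrow> set xs \<subseteq> set vs \<longrightarrow>
        insensitive_beyond (set vs, set ` set es) lam (set xs) (1 / real (Suc k)) r"
      and \<Lambda>: "finite \<Lambda>" and \<epsilon>: "\<epsilon> > 0"
    obtain xs where xs: "set xs = \<Lambda>" using finite_list[OF \<Lambda>] ..
    obtain k where k: "1 / real (Suc k) < \<epsilon>" using nat_approx_posE[OF \<epsilon>] by metis
    obtain r where r: "\<And>vs es. subgraph (set vs, set ` set es) (tree_of c) \<Longrightarrow> \<Lambda> \<subseteq> set vs \<Longrightarrow>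
        insensitive_beyond (set vs, set ` set es) lam \<Lambda> (1 / real (Suc k)) r"
      using R[rule_format, of xs k] xs by blast
    have "insensitive_beyond H lam \<Lambda> \<epsilon> r"
      if H: "subgraph H (tree_of c)" "finite (verts H)" "\<Lambda> \<subseteq> verts H" for H
    proof -
      have sub: "edges H \<subseteq> Pow (verts H)" using H(1) by (auto simp: subgraph_def simple_graph_def)
      obtain vs where vs: "set vs = verts H" using finite_list[OF H(2)] ..
      obtain es where es: "set ` set es = edges H"
      proof (rule finite_sets_eq_set_image)
        show "finite (edges H)" using sub H(2) by (meson finite_Pow_iff finite_subset)
        show "finite e" if "e \<in> edges H" for e using that sub H(2) by (meson PowD finite_subset subsetD)
      qed
      have "H = (set vs, set ` set es)" using vs es by simp
      then have "insensitive_beyond H lam \<Lambda> (1 / real (Suc k)) r" using r[of vs es] H by simp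
      then show ?thesis using k by (simp add: insensitive_beyond_weaken)
    qed
    then show "\<exists>r. \<forall>H. subgraph H (tree_of c) \<longrightarrow> finite (verts H) \<longrightarrow> \<Lambda> \<subseteq> verts H \<longrightarrow>
        insensitive_beyond H lam \<Lambda> \<epsilon> r" by blast
  qed
  show ?thesis unfolding eq by measurable
qed

lemma pred_finite_tree_verts: "Measurable.pred (poisson_offspring d) (\<lambda>c. finite (tree_verts c))"
proof -
  have "finite (tree_verts c) \<longleftrightarrow> (\<exists>xs. \<forall>v. v \<in> tree_verts c \<longrightarrow> v \<in> set xs)" for c
    using finite_list[of "tree_verts c"] finite_subset[of "tree_verts c" "set _"] by blast
  then show ?thesis by simp
qed

text \<open>Finiteness is equivalent to finiteness of all children's subtrees. This is what turns
  the inequality for inherited properties into an equation for the extinction probability.\<close>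

lemma finite_tree_verts_iff:
  "finite (tree_verts c) \<longleftrightarrow> (\<forall>i<c []. finite (tree_verts (child c i)))"
proof -
  have eq: "tree_verts c = insert [] (\<Union>i<c []. Cons i ` tree_verts (child c i))"
  proof (rule set_eqI)
    fix v show "v \<in> tree_verts c \<longleftrightarrow> v \<in> insert [] (\<Union>i<c []. Cons i ` tree_verts (child c i))"
      by (cases v) (auto simp: Nil_in_tree_verts Cons_in_tree_verts)
  qed
  have "finite (tree_verts c) \<longleftrightarrow> (\<forall>i<c []. finite (Cons i ` tree_verts (child c i)))"
    by (subst eq) (auto simp: finite_UN)
  then show ?thesis by (simp add: finite_image_iff)
qed


section \<open>The zero-one law\<close>

lemma prob_space_poisson_offspring: "prob_space (poisson_offspring d)"
  unfolding poisson_offspring_def by (intro prob_space_PiM prob_space_measure_pmf)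

lemma indep_vars_offspring:
  "prob_space.indep_vars (poisson_offspring d) (\<lambda>_. measure_pmf (poisson_pmf d)) (\<lambda>v c. c v) UNIV"
proof -
  interpret prob_space "poisson_offspring d" by (rule prob_space_poisson_offspring)
  let ?N = "\<lambda>_::nat list. measure_pmf (poisson_pmf d)"
  have "distr (poisson_offspring d) (Pi\<^sub>M UNIV ?N) (\<lambda>c. \<lambda>v\<in>UNIV. c v) = poisson_offspring d"
    by (simp add: poisson_offspring_def restrict_UNIV)
  moreover have "distr (poisson_offspring d) (?N v) (\<lambda>c. c v) = ?N v" for v
    unfolding poisson_offspring_def by (rule distr_PiM_component) (simp_all add: prob_space_measure_pmf)
  moreover have "(\<lambda>c. c v) \<in> measurable (poisson_offspring d) (?N v)" for v
    by (simp cong: measurable_cong_sets)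
  ultimately show ?thesis
    by (subst indep_vars_iff_distr_eq_PiM') (simp_all add: poisson_offspring_def)
qed

lemma measurable_child [measurable]:
  "(\<lambda>c. child c i) \<in> measurable (poisson_offspring d) (poisson_offspring d)"
  unfolding poisson_offspring_def child_def
  by (rule measurable_PiM_single', rule measurable_component_singleton) (auto simp: space_PiM)

lemma distr_child: "distr (poisson_offspring d) (poisson_offspring d) (\<lambda>c. child c i) = poisson_offspring d"
  using distr_PiM_reindex[of UNIV "\<lambda>_. measure_pmf (poisson_pmf d)" "Cons i" UNIV]
  by (simp add: poisson_offspring_def child_def[abs_def] prob_space_measure_pmf restrict_UNIV)

text \<open>Labels are partitioned by their first entry, the root forming a class of its own. The
  offspring number of the root and the shifted families \<open>child c i\<close> read different
  classes, so they are independent, and each \<open>child c i\<close> has the law of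
  \<open>c\<close>.\<close>

lemma prob_children_all:
  assumes A: "A \<in> sets (poisson_offspring d)"
  shows "measure (poisson_offspring d) {c. c [] = n \<and> (\<forall>i<n. child c i \<in> A)} =
    pmf (poisson_pmf d) n * measure (poisson_offspring d) A ^ n"
proof -
  let ?M = "poisson_offspring d" and ?N = "\<lambda>_::nat list. measure_pmf (poisson_pmf d)"
  interpret prob_space ?M by (rule prob_space_poisson_offspring)
  \<comment> \<open>Block 0 is the root and block \<open>Suc i\<close> holds the labels starting
    with \<open>i\<close>, so \<open>{..n}\<close> stands for the root and its first
    \<open>n\<close> children.\<close>
  define K where "K j = (case j of 0 \<Rightarrow> {[]} | Suc i \<Rightarrow> range (Cons i))" for j :: nat
  define E where "E j = (case j of 0 \<Rightarrow> {f \<in> space (Pi\<^sub>M (K 0) ?N). f [] = n}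
    | Suc i \<Rightarrow> {f \<in> space (Pi\<^sub>M (K (Suc i)) ?N). child f i \<in> A})" for j :: nat
  define X where "X j c = restrict c (K j)" for j and c :: "nat list \<Rightarrow> nat"
  have "disjoint_family_on K UNIV"
    by (auto simp: disjoint_family_on_def K_def split: nat.splits)
  with indep_vars_restrict[OF indep_vars_offspring, of UNIV K]
  have indep: "indep_vars (\<lambda>j. Pi\<^sub>M (K j) ?N) X UNIV"
    by (simp add: X_def[abs_def])
  have E: "E j \<in> sets (Pi\<^sub>M (K j) ?N)" for j
  proof (cases j)
    case 0
    have "(\<lambda>f. f []) \<in> measurable (Pi\<^sub>M (K 0) ?N) (?N [])"
      by (rule measurable_component_singleton) (simp add: K_def)
    from measurable_sets[OF this, of "{n}"] show ?thesis
      by (simp add: 0 E_def vimage_def Int_def conj_commute)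
  next
    case (Suc i)
    have "(\<lambda>f. child f i) \<in> measurable (Pi\<^sub>M (K (Suc i)) ?N) ?M"
      unfolding poisson_offspring_def child_def
    proof (rule measurable_PiM_single')
      show "(\<lambda>f. f (i # v)) \<in> measurable (Pi\<^sub>M (K (Suc i)) ?N) (?N v)" for v
        by (rule measurable_component_singleton) (simp add: K_def)
    qed simp
    from measurable_sets[OF this A] show ?thesis
      by (simp add: Suc E_def vimage_def Int_def conj_commute)
  qed
  have X0: "X 0 -` E 0 \<inter> space ?M = {c. c [] = n}"
    by (auto simp: X_def E_def K_def space_PiM space_poisson_offspring)
  have XS: "X (Suc i) -` E (Suc i) \<inter> space ?M = {c. child c i \<in> A}" for i
  proof -
    have "child (X (Suc i) c) i = child c i" for c by (simp add: child_def X_def K_def)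
    moreover have "X (Suc i) c \<in> space (Pi\<^sub>M (K (Suc i)) ?N)" for c by (simp add: X_def space_PiM)
    ultimately show ?thesis by (simp add: E_def vimage_def space_poisson_offspring)
  qed
  have "{c. c [] = n \<and> (\<forall>i<n. child c i \<in> A)} = (\<Inter>j\<in>{..n}. X j -` E j \<inter> space ?M)"
  proof (rule set_eqI)
    fix c
    have "c \<in> {c. c [] = n \<and> (\<forall>i<n. child c i \<in> A)} \<longleftrightarrow>
        c \<in> X 0 -` E 0 \<inter> space ?M \<and> (\<forall>i\<in>{..<n}. c \<in> X (Suc i) -` E (Suc i) \<inter> space ?M)"
      unfolding X0 XS by (simp add: Ball_def)
    also have "\<dots> \<longleftrightarrow> (\<forall>j\<in>{..n}. c \<in> X j -` E j \<inter> space ?M)"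
      unfolding lessThan_Suc_atMost[symmetric] lessThan_Suc_eq_insert_0 by blast
    finally show "c \<in> {c. c [] = n \<and> (\<forall>i<n. child c i \<in> A)} \<longleftrightarrow>
        c \<in> (\<Inter>j\<in>{..n}. X j -` E j \<inter> space ?M)" by (simp only: INT_iff)
  qed
  then have "prob {c. c [] = n \<and> (\<forall>i<n. child c i \<in> A)} = (\<Prod>j\<in>{..n}. prob (X j -` E j \<inter> space ?M))"
    using indep_varsD[OF indep, of "{..n}" E] E by simp
  also have "\<dots> = prob (X 0 -` E 0 \<inter> space ?M) * (\<Prod>i<n. prob (X (Suc i) -` E (Suc i) \<inter> space ?M))"
    by (rule prod.atMost_shift)
  also have "prob (X 0 -` E 0 \<inter> space ?M) = pmf (poisson_pmf d) n"
  proof -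
    have eq: "distr ?M (?N []) (\<lambda>c. c []) = ?N []"
      unfolding poisson_offspring_def by (rule distr_PiM_component) (simp_all add: prob_space_measure_pmf)
    have "pmf (poisson_pmf d) n = measure (distr ?M (?N []) (\<lambda>c. c [])) {n}"
      unfolding eq by (simp add: measure_pmf_single)
    also have "\<dots> = prob ((\<lambda>c. c []) -` {n} \<inter> space ?M)"
      by (rule measure_distr) (simp_all cong: measurable_cong_sets)
    finally show ?thesis unfolding X0 by (simp add: space_poisson_offspring vimage_def)
  qed
  also have "(\<Prod>i<n. prob (X (Suc i) -` E (Suc i) \<inter> space ?M)) = prob A ^ n"
  proof -
    have "prob A = measure (distr ?M ?M (\<lambda>c. child c i)) A" for i
      by (simp add: distr_child)
    also have "\<dots> i = prob ((\<lambda>c. child c i) -` A \<inter> space ?M)" for i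
      using A by (intro measure_distr) auto
    finally have "prob {c. child c i \<in> A} = prob A" for i
      by (simp add: space_poisson_offspring vimage_def)
    then show ?thesis unfolding XS by simp
  qed
  finally show ?thesis .
qed

text \<open>The generating function of the offspring distribution is \<open>\<lambda>s. exp (d * (s - 1))\<close>.\<close>

lemma prob_children_all_gf:
  assumes d: "d > 0" and A: "A \<in> sets (poisson_offspring d)"
  shows "measure (poisson_offspring d) {c. \<forall>i<c []. child c i \<in> A} =
    exp (d * (measure (poisson_offspring d) A - 1))"
proof -
  let ?M = "poisson_offspring d"
  interpret prob_space ?M by (rule prob_space_poisson_offspring)
  define B where "B n = {c. c [] = n \<and> (\<forall>i<n. child c i \<in> A)}" for n
  have [measurable]: "Measurable.pred ?M (\<lambda>c. child c i \<in> A)" for i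
    using measurable_sets[OF measurable_child A]
    by (simp add: pred_def vimage_def Int_def conj_commute)
  have "B n \<in> sets ?M" for n
  proof -
    have "Measurable.pred ?M (\<lambda>c. c [] = n \<and> (\<forall>i<n. child c i \<in> A))"
      by (intro pred_intros_logic pred_offspring pred_intros_countable pred_intros_imp') measurable
    then show ?thesis by (simp add: pred_def B_def space_poisson_offspring)
  qed
  moreover have "disjoint_family B" by (auto simp: disjoint_family_on_def B_def)
  ultimately have "(\<lambda>n. prob (B n)) sums prob (\<Union>n. B n)"
    by (intro finite_measure_UNION) auto
  moreover have "prob (B n) = exp (- d) * ((d * prob A) ^ n /\<^sub>R fact n)" for n
    using prob_children_all[OF A, of n] d
    by (simp add: B_def power_mult_distrib field_simps)
  moreover have "(\<lambda>n. exp (- d) * ((d * prob A) ^ n /\<^sub>R fact n)) sums (exp (- d) * exp (d * prob A))"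
    by (intro sums_mult exp_converges)
  ultimately have "prob (\<Union>n. B n) = exp (- d) * exp (d * prob A)"
    using sums_unique2 by fastforce
  moreover have "(\<Union>n. B n) = {c. \<forall>i<c []. child c i \<in> A}" by (auto simp: B_def)
  ultimately show ?thesis by (simp add: exp_add[symmetric] algebra_simps)
qed

text \<open>The function \<open>g\<close> vanishes at \<open>q\<close> and 1 and is nonnegative at
  \<open>p\<close>. Mean values of its derivative are then nonnegative somewhere between
  \<open>q\<close> and \<open>p\<close> and nonpositive somewhere between \<open>p\<close> and 1,
  although the derivative is strictly increasing.\<close>

lemma exp_fixed_point_gap:
  fixes d p q :: real
  assumes d: "d > 0" and q: "q = exp (d * (q - 1))" and p: "p \<le> exp (d * (p - 1))"
    and qp: "q < p" and p1: "p < 1"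
  shows False
proof -
  define g where "g s = exp (d * (s - 1)) - s" for s
  have deriv: "DERIV g s :> d * exp (d * (s - 1)) - 1" for s
    unfolding g_def by (auto intro!: derivative_eq_intros)
  obtain y where y: "q < y" "y < p" "g p - g q = (p - q) * (d * exp (d * (y - 1)) - 1)"
    using MVT2[OF qp, of g "\<lambda>s. d * exp (d * (s - 1)) - 1"] deriv by blast
  obtain z where z: "p < z" "z < 1" "g 1 - g p = (1 - p) * (d * exp (d * (z - 1)) - 1)"
    using MVT2[OF p1, of g "\<lambda>s. d * exp (d * (s - 1)) - 1"] deriv by blast
  have g: "g q = 0" "g 1 = 0" "g p \<ge> 0" using q p by (simp_all add: g_def)
  have "d * exp (d * (y - 1)) - 1 \<ge> 0"
    using y(3) g qp by (metis diff_gt_0_iff_gt diff_zero zero_le_mult_iff not_less)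
  moreover have "d * exp (d * (z - 1)) - 1 \<le> 0"
    using z(3) g p1 by (smt (verit) mult_pos_pos)
  moreover have "d * exp (d * (y - 1)) < d * exp (d * (z - 1))"
    using y(2) z(1) d by simp
  ultimately show False by simp
qed

text \<open>
  The zero-one law for inherited properties: with \<open>q\<close> the extinction probability and \<open>p \<ge> q\<close> the
  probability of the property, \<open>p\<close> lies below the generating function and \<open>q\<close> is a fixed point, so
  strict convexity leaves only \<open>p = q\<close> and \<open>p = 1\<close>.
\<close>

lemma inherited_property_zero_one:
  assumes d: "d > 0"
    and meas: "Measurable.pred (poisson_offspring d) P"
    and fin: "\<And>c. finite (tree_verts c) \<Longrightarrow> P c"
    and child: "\<And>c i. P c \<Longrightarrow> i < c [] \<Longrightarrow> P (child c i)"
  shows "\<P>(c in poisson_offspring d. P c \<bar> infinite (tree_verts c)) \<in> {0, 1}"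
proof -
  let ?M = "poisson_offspring d"
  interpret prob_space ?M by (rule prob_space_poisson_offspring)
  define A where "A = {c. P c}"
  define F where "F = {c. finite (tree_verts c)}"
  have A: "A \<in> sets ?M" using meas by (simp add: pred_def A_def space_poisson_offspring)
  have F: "F \<in> sets ?M"
    using pred_finite_tree_verts by (simp add: pred_def F_def space_poisson_offspring)
  have FA: "F \<subseteq> A" using fin by (auto simp: A_def F_def)
  have "prob F = exp (d * (prob F - 1))"
  proof -
    have "F = {c. \<forall>i<c []. child c i \<in> F}"
      unfolding F_def mem_Collect_eq by (rule Collect_cong) (rule finite_tree_verts_iff)
    then show ?thesis using prob_children_all_gf[OF d F] by simp
  qed
  moreover have "prob A \<le> exp (d * (prob A - 1))"
  proof -
    have "{c. \<forall>i<c []. child c i \<in> A} \<in> sets ?M"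
    proof -
      have "Measurable.pred ?M (\<lambda>c. child c i \<in> A)" for i
        using measurable_sets[OF measurable_child A]
        by (simp add: pred_def vimage_def Int_def conj_commute)
      then have "Measurable.pred ?M (\<lambda>c. \<forall>i. i < c [] \<longrightarrow> child c i \<in> A)"
        by (intro pred_intros_countable pred_intros_logic pred_offspring)
      then show ?thesis by (simp add: pred_def space_poisson_offspring)
    qed
    moreover have "A \<subseteq> {c. \<forall>i<c []. child c i \<in> A}" using child by (auto simp: A_def)
    ultimately have "prob A \<le> prob {c. \<forall>i<c []. child c i \<in> A}" by (intro finite_measure_mono)
    then show ?thesis using prob_children_all_gf[OF d A] by simp
  qed
  moreover have "prob F \<le> prob A" using FA A by (rule finite_measure_mono)
  ultimately consider "prob A = prob F" | "prob A = 1"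
    using exp_fixed_point_gap[OF d, of "prob F" "prob A"] prob_le_1[of A] by (meson linorder_neqE_linordered_idom not_less)
  moreover have "prob (A - F) = prob A - prob F" using A F FA by (rule finite_measure_Diff)
  moreover have "prob (- F) = 1 - prob F"
    using prob_compl[OF F] by (simp add: space_poisson_offspring Compl_eq_Diff_UNIV)
  moreover have "\<P>(c in ?M. P c \<bar> infinite (tree_verts c)) = prob (A - F) / prob (- F)"
    by (simp add: cond_prob_def A_def F_def space_poisson_offspring Diff_eq Collect_neg_eq[symmetric] Collect_conj_eq[symmetric])
  \<comment> \<open>For \<open>prob A = prob F\<close> the numerator is 0. For
    \<open>prob A = 1\<close> numerator and denominator coincide; the quotient is 1, or 0 by the
    convention for division by zero.\<close>
  ultimately show ?thesis by cases auto
qed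

theorem theorem1p1:
  fixes d lam :: real
  assumes "d > 1" and "lam > 0"
  shows
    "{c \<in> space (poisson_offspring d). weak_spatial_mixing (tree_of c) lam}
       \<in> sets (poisson_offspring d) \<and>
     \<P>(c in poisson_offspring d. weak_spatial_mixing (tree_of c) lam \<bar>
         infinite (verts (tree_of c))) \<in> {0, 1} \<and>
     {c \<in> space (poisson_offspring d). strong_spatial_mixing (tree_of c) lam}
       \<in> sets (poisson_offspring d) \<and>
     \<P>(c in poisson_offspring d. strong_spatial_mixing (tree_of c) lam \<bar>
         infinite (verts (tree_of c))) \<in> {0, 1}"
proof -
  have d: "d > 0" using assms(1) by simp
  have wsm: "Measurable.pred (poisson_offspring d) (\<lambda>c. weak_spatial_mixing (tree_of c) lam)"
    using assms(2) by (rule pred_weak_spatial_mixing_tree_of)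
  have ssm: "Measurable.pred (poisson_offspring d) (\<lambda>c. strong_spatial_mixing (tree_of c) lam)"
    using assms(2) by (rule pred_strong_spatial_mixing_tree_of)
  have "\<P>(c in poisson_offspring d. weak_spatial_mixing (tree_of c) lam \<bar>
      infinite (tree_verts c)) \<in> {0, 1}"
    using d wsm
  proof (rule inherited_property_zero_one)
    show "weak_spatial_mixing (tree_of c) lam" if "finite (tree_verts c)" for c
      using assms(2) simple_graph_tree_of that
      by (intro weak_spatial_mixing_finite) (simp_all add: verts_tree_of)
    show "weak_spatial_mixing (tree_of (child c i)) lam"
      if "weak_spatial_mixing (tree_of c) lam" "i < c []" for c i
      using assms(2) that(2,1) by (rule weak_spatial_mixing_child)
  qed
  moreover have "\<P>(c in poisson_offspring d. strong_spatial_mixing (tree_of c) lam \<bar>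
      infinite (tree_verts c)) \<in> {0, 1}"
    using d ssm
  proof (rule inherited_property_zero_one)
    show "strong_spatial_mixing (tree_of c) lam" if "finite (tree_verts c)" for c
      unfolding strong_spatial_mixing_def
    proof (intro allI impI)
      fix H assume "subgraph H (tree_of c)"
      then have "simple_graph H" "finite (verts H)"
        using that by (auto simp: subgraph_def verts_tree_of intro: finite_subset)
      with assms(2) show "weak_spatial_mixing H lam" by (rule weak_spatial_mixing_finite)
    qed
    show "strong_spatial_mixing (tree_of (child c i)) lam"
      if "strong_spatial_mixing (tree_of c) lam" "i < c []" for c i
      using assms(2) that(2,1) by (rule strong_spatial_mixing_child)
  qed
  ultimately show ?thesis
    using wsm ssm unfolding pred_def verts_tree_of by (intro conjI)
qed

end
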